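(* Let $S\subset\mathbb{N}\setminus\{1\}$ satisfy $1\le |S|\le 3$, and assume that $\operatorname{lcm}(S)$ has at most two distinct prime factors. Then $\mathrm{MIN}(S)=\mathrm{FIB}(S)$.
   Context: $\mathbb{N}=\{1,2,\dots\}$, $\mathbb{N}_0=\mathbb{N}\cup\{0\}$. For a finite nonempty set $A\subset\mathbb{N}_0$, its mask polynomial is $A(X)=\sum_{a\in A}X^a$. $\Phi_s(X)$ denotes the $s$-th cyclotomic polynomial. $\operatorname{lcm}(S)$ is the least common multiple of the elements of $S$. For a finite nonempty $S\subset\mathbb{N}\setminus\{1\}$, $\mathrm{MIN}(S)$ is the minimum of $|A|$ over all finite nonempty sets $A\subset\mathbb{N}_0$ such that $\Phi_s(X)\mid A(X)$ for all $s\in S$. For $N\in\mathbb{N}$ and a prime $p\mid N$, let $F^N_p(X)=\Phi_p(X^{N/p})=1+X^{N/p}+\dots+X^{(p-1)N/p}$. A finite nonempty set $A\subset\mathbb{N}_0$ is fibered on scale $N$ if there is a prime $p\mid N$ such that $F^N_p(X)\mid A(X)$ modulo $X^N-1$, i.e. $A(X)\equiv Q(X)F^N_p(X) \bmod (X^N-1)$ for some polynomial $Q$ with integer coefficients (since $F_p^N(X)\mid X^N-1$, this is equivalent to $F^N_p(X)\mid A(X)$). $\mathrm{FIB}(S)$ is the smallest size of a finite nonempty set $A\subset\mathbb{N}_0$ that is fibered on each scale $s\in S$ (the prime $p$ may depend on $s$). *)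

theory Defs
  imports
    Complex_Main
    "HOL-Computational_Algebra.Computational_Algebra"
begin

definition primitive_roots_of_unity :: "nat \<Rightarrow> complex set" where
  "primitive_roots_of_unity n = {z. z ^ n = 1 \<and> (\<forall>m. 0 < m \<and> m < n \<longrightarrow> z ^ m \<noteq> 1)}"

text \<open>
  The library has no cyclotomic polynomials. The description below determines a unique integer
  polynomial for \<open>n > 0\<close>, see \<open>of_int_cyclotomic\<close>. Divisibility is always taken in the ring
  of integer polynomials.
\<close>

definition cyclotomic :: "nat \<Rightarrow> int poly" where
  "cyclotomic n = (THE p. map_poly of_int p = (\<Prod>z\<in>primitive_roots_of_unity n. [:- z, 1:]))"

definition mask_poly :: "nat set \<Rightarrow> int poly" where
  "mask_poly A = (\<Sum>a\<in>A. monom 1 a)"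

definition fiber_poly :: "nat \<Rightarrow> nat \<Rightarrow> int poly" where
  "fiber_poly N p = pcompose (cyclotomic p) (monom 1 (N div p))"

definition fibered_on_scale :: "nat set \<Rightarrow> nat \<Rightarrow> bool" where
  "fibered_on_scale A N \<longleftrightarrow>
     (\<exists>p. prime p \<and> p dvd N \<and>
        (\<exists>Q. (monom 1 N - 1) dvd (mask_poly A - Q * fiber_poly N p)))"

text \<open>
  These are MIN(S) and FIB(S); the bare name \<open>MIN\<close> is library syntax for minima over sets.
  The two minima are attained, so \<open>LEAST\<close> is meaningful, whenever \<open>S\<close> is a finite set of
  integers \<open>\<ge> 2\<close>; see \<open>MIN_card_attained\<close> and \<open>FIB_card_attained\<close>.
\<close>

definition MIN_card :: "nat set \<Rightarrow> nat" where
  "MIN_card S = (LEAST n. \<exists>A. finite A \<and> A \<noteq> {} \<and> card A = n \<and>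
              (\<forall>s\<in>S. cyclotomic s dvd mask_poly A))"

definition FIB_card :: "nat set \<Rightarrow> nat" where
  "FIB_card S = (LEAST n. \<exists>A. finite A \<and> A \<noteq> {} \<and> card A = n \<and>
              (\<forall>s\<in>S. fibered_on_scale A s))"

abbreviation cpoly :: "int poly \<Rightarrow> complex poly" where
  "cpoly \<equiv> map_poly of_int"

lemma cpoly_add: "cpoly (p + q) = cpoly p + cpoly q"
  by (intro poly_eqI) (simp add: coeff_map_poly)

lemma cpoly_diff: "cpoly (p - q) = cpoly p - cpoly q"
  by (intro poly_eqI) (simp add: coeff_map_poly)

lemma cpoly_mult: "cpoly (p * q) = cpoly p * cpoly q"
  by (intro poly_eqI) (simp add: coeff_map_poly coeff_mult)

lemma cpoly_prod: "cpoly (prod f A) = (\<Prod>x\<in>A. cpoly (f x))"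
  by (induction A rule: infinite_finite_induct) (simp_all add: cpoly_mult)

lemma cpoly_inj: "cpoly p = cpoly q \<longleftrightarrow> p = q"
  by (auto simp: poly_eq_iff coeff_map_poly)

lemma degree_cpoly: "degree (cpoly p) = degree p"
  by (rule degree_map_poly) auto

lemma lead_coeff_cpoly: "lead_coeff (cpoly p) = of_int (lead_coeff p)"
  by (simp add: coeff_map_poly degree_cpoly)

lemma roots_of_unity_partition:
  assumes "n > 0"
  shows "{z::complex. z ^ n = 1} = (\<Union>d\<in>{d. d dvd n}. primitive_roots_of_unity d)"
proof (intro subset_antisym subsetI)
  fix z :: complex
  assume "z \<in> {z. z ^ n = 1}"
  hence z: "z ^ n = 1" by simp
  define d where "d = (LEAST m. 0 < m \<and> z ^ m = 1)"
  have d: "0 < d \<and> z ^ d = 1"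
    unfolding d_def by (rule LeastI[of _ n]) (use assms z in simp)
  have least: "z ^ m \<noteq> 1" if "0 < m" "m < d" for m
    using not_less_Least[of m "\<lambda>m. 0 < m \<and> z ^ m = 1"] that unfolding d_def by auto
  have "z ^ n = (z ^ d) ^ (n div d) * z ^ (n mod d)"
    by (metis mult_div_mod_eq power_add power_mult)
  hence "z ^ (n mod d) = 1" using z d by simp
  moreover have "n mod d < d" using d by simp
  ultimately have "n mod d = 0" using least by blast
  hence "d dvd n" by auto
  thus "z \<in> (\<Union>d\<in>{d. d dvd n}. primitive_roots_of_unity d)"
    using d least by (auto simp: primitive_roots_of_unity_def)
next
  fix z :: complex
  assume "z \<in> (\<Union>d\<in>{d. d dvd n}. primitive_roots_of_unity d)"
  thus "z \<in> {z. z ^ n = 1}"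
    by (auto simp: primitive_roots_of_unity_def power_mult elim: dvdE)
qed

lemma prod_primitive_roots:
  assumes "n > 0"
  shows "(\<Prod>d | d dvd n. \<Prod>z\<in>primitive_roots_of_unity d. [:- z, 1:]) = monom 1 n - 1"
proof -
  let ?p = "monom 1 n - 1 :: complex poly"
  have deg: "degree ?p = n"
    using assms degree_add_eq_left[of "-1" "monom 1 n :: complex poly"] by (simp add: degree_monom_eq)
  hence lc: "lead_coeff ?p = 1"
    using assms by simp
  have roots: "poly ?p z = 0 \<longleftrightarrow> z ^ n = 1" for z
    by (simp add: poly_monom)
  have "rsquarefree ?p"
    unfolding rsquarefree_roots
    using assms by (auto simp: pderiv_diff pderiv_monom poly_monom power_0_left)
  hence "smult (lead_coeff ?p) (\<Prod>z | poly ?p z = 0. [:-z, 1:]) = ?p"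
    by (rule complex_poly_decompose_rsquarefree)
  hence *: "(\<Prod>z | z ^ n = 1. [:-z, 1:]) = ?p"
    using lc roots by simp
  have fin: "finite {z::complex. z ^ n = 1}"
    using finite_roots_unity[of n] assms by simp
  have "(\<Prod>z | z ^ n = 1. [:-z, 1:]) =
      (\<Prod>d | d dvd n. \<Prod>z\<in>primitive_roots_of_unity d. [:- z, 1:])"
    unfolding roots_of_unity_partition[OF assms]
  proof (rule prod.UNION_disjoint)
    show "finite {d. d dvd n}" using assms by simp
    show "\<forall>d\<in>{d. d dvd n}. finite (primitive_roots_of_unity d)"
      using fin roots_of_unity_partition[OF assms] by (metis (no_types, lifting) UN_upper finite_subset)
    show "\<forall>i\<in>{d. d dvd n}. \<forall>j\<in>{d. d dvd n}. i \<noteq> j \<longrightarrow>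
        primitive_roots_of_unity i \<inter> primitive_roots_of_unity j = {}"
    proof (intro ballI impI)
      fix i j assume "i \<in> {d. d dvd n}" "j \<in> {d. d dvd n}" "i \<noteq> j"
      hence "i > 0" "j > 0" "i < j \<or> j < i" using assms by (auto intro: Nat.gr0I)
      thus "primitive_roots_of_unity i \<inter> primitive_roots_of_unity j = {}"
        by (auto simp: primitive_roots_of_unity_def)
    qed
  qed
  with * show ?thesis by simp
qed

lemma ex_int_cyclotomic:
  assumes "n > 0"
  shows "\<exists>p. cpoly p = (\<Prod>z\<in>primitive_roots_of_unity n. [:- z, 1:])"
  using assms
proof (induction n rule: less_induct)
  case (less n)
  let ?C = "\<lambda>n. (\<Prod>z\<in>primitive_roots_of_unity n. [:- z, 1:])"
  let ?D = "{d. d dvd n \<and> d \<noteq> n}"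
  have D: "0 < d \<and> d < n" if "d \<in> ?D" for d
    using that less.prems by (auto intro!: Nat.gr0I le_neq_implies_less dvd_imp_le)
  have "\<forall>d\<in>?D. \<exists>p. cpoly p = ?C d" using D less.IH by blast
  then obtain f where f: "\<And>d. d \<in> ?D \<Longrightarrow> cpoly (f d) = ?C d" by metis
  define G where "G = prod f ?D"
  have cG: "cpoly G = (\<Prod>d\<in>?D. ?C d)"
    unfolding G_def cpoly_prod using f by (intro prod.cong) auto
  have C_monic: "lead_coeff (?C d) = 1" for d
    by (simp add: lead_coeff_prod)
  have "lead_coeff (cpoly G) = 1"
    unfolding cG lead_coeff_prod using C_monic by simp
  hence lG: "lead_coeff G = 1" by (simp add: lead_coeff_cpoly)
  hence G0: "G \<noteq> 0" by auto
  have split: "{d. d dvd n} = insert n ?D" by auto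
  have "finite ?D" using less.prems by simp
  have prod: "monom 1 n - 1 = ?C n * cpoly G"
    using prod_primitive_roots[OF less.prems] \<open>finite ?D\<close>
    unfolding split by (subst (asm) prod.insert) (simp_all add: cG)
  obtain q r where qr: "pseudo_divmod (monom 1 n - 1) G = (q, r)" by fastforce
  have eq: "monom 1 n - 1 = G * q + r" and r: "r = 0 \<or> degree r < degree G"
    using pseudo_divmod[OF G0 qr] lG by simp_all
  have "cpoly (monom 1 n - 1) = monom 1 n - 1"
    by (simp add: cpoly_diff map_poly_monom)
  hence "cpoly G * cpoly q + cpoly r = ?C n * cpoly G"
    using arg_cong[OF eq, of cpoly] prod by (simp add: cpoly_add cpoly_mult)
  hence rr: "cpoly G * (?C n - cpoly q) = cpoly r" by (simp add: algebra_simps)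
  have "?C n - cpoly q = 0"
  proof (rule ccontr)
    assume nz: "?C n - cpoly q \<noteq> 0"
    have "cpoly G \<noteq> 0" using G0 cpoly_inj[of G 0] by simp
    hence "cpoly r \<noteq> 0" and "degree (cpoly r) \<ge> degree (cpoly G)"
      using nz by (simp_all flip: rr add: degree_mult_eq)
    thus False using r by (auto simp: degree_cpoly)
  qed
  thus ?case by (intro exI[of _ q]) simp
qed

lemma of_int_cyclotomic:
  assumes "n > 0"
  shows "map_poly of_int (cyclotomic n) = (\<Prod>z\<in>primitive_roots_of_unity n. [:- z, 1:])"
proof -
  have "\<exists>!p. cpoly p = (\<Prod>z\<in>primitive_roots_of_unity n. [:- z, 1:])"
    using ex_int_cyclotomic[OF assms] cpoly_inj by metis
  thus ?thesis unfolding cyclotomic_def by (rule theI')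
qed

lemma prod_cyclotomic:
  assumes "n > 0"
  shows "(\<Prod>d | d dvd n. cyclotomic d) = monom 1 n - 1"
proof -
  have "cpoly (\<Prod>d | d dvd n. cyclotomic d) =
      (\<Prod>d | d dvd n. \<Prod>z\<in>primitive_roots_of_unity d. [:- z, 1:])"
    unfolding cpoly_prod using assms
    by (intro prod.cong) (auto intro!: of_int_cyclotomic Nat.gr0I)
  also have "\<dots> = cpoly (monom 1 n - 1)"
    by (simp add: prod_primitive_roots assms cpoly_diff map_poly_monom)
  finally show ?thesis by (simp only: cpoly_inj)
qed

lemma cyclotomic_1: "cyclotomic 1 = monom 1 1 - 1"
  using prod_cyclotomic[of 1] by simp

lemma monom_minus_1_nonzero:
  assumes "n > 0"
  shows "monom 1 n - (1 :: int poly) \<noteq> 0"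
proof
  assume "monom 1 n - (1 :: int poly) = 0"
  hence "coeff (monom 1 n - (1 :: int poly)) n = 0" by (simp only: coeff_0)
  thus False using assms by simp
qed

lemma geometric_monom:
  "(monom 1 m - 1) * (\<Sum>i<n. monom 1 (i * m)) = monom 1 (n * m) - (1 :: int poly)"
proof -
  have "monom 1 m ^ i = (monom 1 (i * m) :: int poly)" for i
    by (simp add: monom_power mult.commute)
  thus ?thesis
    using power_diff_1_eq[of "monom 1 m :: int poly" n] by simp
qed

lemma cyclotomic_prime:
  assumes "prime p"
  shows "cyclotomic p = (\<Sum>i<p. monom 1 i)"
proof -
  have "p > 1" using assms by (rule prime_gt_1_nat)
  have "{d. d dvd p} = {1, p}" using assms by (auto simp: prime_nat_iff)
  hence "cyclotomic 1 * cyclotomic p = monom 1 p - 1"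
    using prod_cyclotomic[of p] \<open>p > 1\<close> by (simp del: One_nat_def)
  also have "\<dots> = (monom 1 1 - 1) * (\<Sum>i<p. monom 1 i)"
    using geometric_monom[of 1 p] by simp
  finally show ?thesis
    using monom_minus_1_nonzero[of 1] unfolding cyclotomic_1 by simp
qed

lemma fiber_poly_eq:
  assumes "prime p"
  shows "fiber_poly N p = (\<Sum>i<p. monom 1 (i * (N div p)))"
proof -
  have "pcompose (monom 1 i) (monom 1 k) = (monom 1 (i * k) :: int poly)" for i k
    by (induction i) (simp_all add: monom_0 monom_Suc pcompose_pCons mult_monom pcompose_1 flip: monom_0)
  thus ?thesis
    unfolding fiber_poly_def cyclotomic_prime[OF assms] by (simp add: pcompose_sum)
qed

lemma mask_interval: "(monom 1 1 - 1) * mask_poly {..<n} = monom 1 n - 1"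
  using geometric_monom[of 1 n] by (simp add: mask_poly_def)

lemma cyclotomic_dvd_mask_interval:
  assumes "1 < s" "s dvd M" "M > 0"
  shows "cyclotomic s dvd mask_poly {..<M}"
proof -
  have "(\<Prod>d\<in>{1, s}. cyclotomic d) dvd (\<Prod>d | d dvd M. cyclotomic d)"
    using assms by (intro prod_dvd_prod_subset) auto
  hence "cyclotomic 1 * cyclotomic s dvd (monom 1 1 - 1) * mask_poly {..<M}"
    using assms by (simp add: prod_cyclotomic mask_interval del: One_nat_def)
  thus ?thesis
    using monom_minus_1_nonzero[of 1] unfolding cyclotomic_1 by simp
qed

lemma fibered_interval:
  assumes "1 < s" "s dvd M" "M > 0"
  shows "fibered_on_scale {..<M} s"
proof -
  obtain p where p: "prime p" "p dvd s"
    using prime_factor_nat[of s] assms by auto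
  obtain m where s: "s = p * m" using p by blast
  obtain k where M: "M = k * s" using assms by (auto elim: dvdE)
  have "m > 0" "p > 0" using s assms by (auto intro: Nat.gr0I)
  have F: "fiber_poly s p = (\<Sum>i<p. monom 1 (i * m))"
    using p \<open>p > 0\<close> by (simp add: fiber_poly_eq s)
  have "(monom 1 1 - 1) * mask_poly {..<M} = (monom 1 1 - 1) *
      (mask_poly {..<m} * (\<Sum>i<k. monom 1 (i * s)) * fiber_poly s p)"
  proof -
    have "(monom 1 1 - 1) * (mask_poly {..<m} * (\<Sum>i<k. monom 1 (i * s)) * fiber_poly s p) =
        (((monom 1 1 - 1) * mask_poly {..<m}) * fiber_poly s p) * (\<Sum>i<k. monom 1 (i * s))"
      by (simp only: mult_ac)
    also have "\<dots> = monom 1 M - 1"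
      unfolding mask_interval F geometric_monom s[symmetric] M ..
    finally show ?thesis by (simp only: mask_interval)
  qed
  hence "mask_poly {..<M} = mask_poly {..<m} * (\<Sum>i<k. monom 1 (i * s)) * fiber_poly s p"
    by (rule mult_left_cancel[THEN iffD1, rotated]) (rule monom_minus_1_nonzero, simp)
  thus ?thesis
    unfolding fibered_on_scale_def using p by (metis diff_self dvd_0_right)
qed

lemma MIN_card_attained:
  assumes "finite S" "S \<subseteq> {2..}"
  shows "\<exists>A. finite A \<and> A \<noteq> {} \<and> card A = MIN_card S \<and> (\<forall>s\<in>S. cyclotomic s dvd mask_poly A)"
proof -
  have M: "Lcm S > 0"
    using assms by (intro Nat.gr0I) (auto simp: Lcm_0_iff)
  have "finite {..<Lcm S} \<and> {..<Lcm S} \<noteq> {} \<and> card {..<Lcm S} = Lcm S \<and>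
      (\<forall>s\<in>S. cyclotomic s dvd mask_poly {..<Lcm S})"
    using assms M by (auto intro!: cyclotomic_dvd_mask_interval dvd_Lcm)
  hence "\<exists>n A. finite A \<and> A \<noteq> {} \<and> card A = n \<and> (\<forall>s\<in>S. cyclotomic s dvd mask_poly A)"
    by blast
  thus ?thesis unfolding MIN_card_def by (rule LeastI_ex)
qed

lemma FIB_card_attained:
  assumes "finite S" "S \<subseteq> {2..}"
  shows "\<exists>A. finite A \<and> A \<noteq> {} \<and> card A = FIB_card S \<and> (\<forall>s\<in>S. fibered_on_scale A s)"
proof -
  have M: "Lcm S > 0"
    using assms by (intro Nat.gr0I) (auto simp: Lcm_0_iff)
  have "finite {..<Lcm S} \<and> {..<Lcm S} \<noteq> {} \<and> card {..<Lcm S} = Lcm S \<and>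
      (\<forall>s\<in>S. fibered_on_scale {..<Lcm S} s)"
    using assms M by (auto intro!: fibered_interval dvd_Lcm)
  hence "\<exists>n A. finite A \<and> A \<noteq> {} \<and> card A = n \<and> (\<forall>s\<in>S. fibered_on_scale A s)"
    by blast
  thus ?thesis unfolding FIB_card_def by (rule LeastI_ex)
qed

end

theory Submission
  imports Defs "HOL-Number_Theory.Cong"
begin

text \<open>
  Write the elements of \<open>S\<close> as \<open>p^a q^b\<close> and look at the digits of the elements of \<open>A\<close> in bases
  \<open>p\<close> and \<open>q\<close>. If \<open>E\<close> and \<open>F\<close> are sets of positive exponents such that every \<open>(a, b)\<close> has
  \<open>a \<in> E\<close> or \<open>b \<in> F\<close>, then a set of size \<open>p^|E| q^|F|\<close> that is fibered on every scale is built
  digit by digit. So it suffices to find such a cover with \<open>p^|E| q^|F| \<le> |A|\<close> whenever the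
  cyclotomic divisibilities hold for \<open>A\<close>.

  Divisibility at \<open>(a, b)\<close> with \<open>a, b > 0\<close> says that \<open>A\<close> has vanishing mixed differences in the
  two digits \<open>a\<close> and \<open>b\<close>. Hence either the \<open>p\<close>-digit is equidistributed, and \<open>(a, b)\<close> can be
  replaced by \<open>(a, 0)\<close>, or all values of the \<open>q\<close>-digit occur; likewise with \<open>p\<close> and \<open>q\<close>
  exchanged. So assume that at every mixed scale all values of both digits occur. If all \<open>a\<close> are
  positive, split \<open>A\<close> by the digit with the least \<open>a\<close>: all \<open>p\<close> parts are nonempty and still
  satisfy the conditions with larger \<open>a\<close>, so induction applies. The same works if all \<open>b\<close> are
  positive. With at most three scales, some of them mixed, the only remaining case is
  \<open>{(a1, 0), (0, b2), (a, b)}\<close>, where \<open>|A| \<ge> min (p^2 q) (p q^2)\<close> unless \<open>a = a1\<close> or \<open>b = b2\<close>.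
\<close>

subsection \<open>Digit conditions\<close>

definition dig :: "nat \<Rightarrow> nat \<Rightarrow> nat \<Rightarrow> nat" where
  "dig p k n = n div p ^ k mod p"

text \<open>The counterpart of divisibility by the cyclotomic polynomial of index \<open>p ^ Suc k\<close>.\<close>

definition unif :: "nat \<Rightarrow> nat \<Rightarrow> nat set \<Rightarrow> bool" where
  "unif p k A \<longleftrightarrow> (\<forall>r. \<forall>i<p. \<forall>i'<p.
     card {n\<in>A. n mod p ^ k = r \<and> dig p k n = i} = card {n\<in>A. n mod p ^ k = r \<and> dig p k n = i'})"

lemma unifD:
  "unif p k A \<Longrightarrow> i < p \<Longrightarrow> i' < p \<Longrightarrow>
     card {n\<in>A. n mod p ^ k = r \<and> dig p k n = i} = card {n\<in>A. n mod p ^ k = r \<and> dig p k n = i'}"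
  unfolding unif_def by blast

text \<open>For coprime \<open>p\<close> and \<open>q\<close>, fixing a residue modulo
  \<open>p ^ k\<close> with the digit at \<open>k\<close>, and likewise for \<open>q\<close> and
  \<open>l\<close>, amounts to fixing the residue modulo
  \<open>p ^ Suc k * q ^ Suc l\<close>.\<close>

definition cell :: "nat \<Rightarrow> nat \<Rightarrow> nat \<Rightarrow> nat \<Rightarrow> nat set \<Rightarrow> nat \<Rightarrow> nat \<Rightarrow> nat \<Rightarrow> nat \<Rightarrow> nat set" where
  "cell p k q l A r t i j =
     {n\<in>A. n mod p ^ k = r \<and> dig p k n = i \<and> n mod q ^ l = t \<and> dig q l n = j}"

text \<open>The counterpart of divisibility by the cyclotomic polynomial of index \<open>p ^ Suc k * q ^ Suc l\<close>.\<close>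

definition bal :: "nat \<Rightarrow> nat \<Rightarrow> nat \<Rightarrow> nat \<Rightarrow> nat set \<Rightarrow> bool" where
  "bal p k q l A \<longleftrightarrow> (\<forall>r t. \<forall>i<p. \<forall>i'<p. \<forall>j<q. \<forall>j'<q.
     card (cell p k q l A r t i j) + card (cell p k q l A r t i' j') =
     card (cell p k q l A r t i j') + card (cell p k q l A r t i' j))"

lemma balD:
  "bal p k q l A \<Longrightarrow> i < p \<Longrightarrow> i' < p \<Longrightarrow> j < q \<Longrightarrow> j' < q \<Longrightarrow>
     card (cell p k q l A r t i j) + card (cell p k q l A r t i' j') =
     card (cell p k q l A r t i j') + card (cell p k q l A r t i' j)"
  unfolding bal_def by blast

lemma bal_commute: "bal p k q l A \<longleftrightarrow> bal q l p k A"
proof -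
  have "bal q l p k A" if "bal p k q l A" for p k q l
  proof -
    have c: "cell q l p k A r t i j = cell p k q l A t r j i" for r t i j
      by (auto simp: cell_def)
    show ?thesis
      unfolding bal_def c
    proof (intro allI impI)
      fix r t i i' j j' assume "i < q" "i' < q" "j < p" "j' < p"
      hence "card (cell p k q l A t r j i) + card (cell p k q l A t r j' i') =
          card (cell p k q l A t r j i') + card (cell p k q l A t r j' i)"
        using that unfolding bal_def by blast
      thus "card (cell p k q l A t r j i) + card (cell p k q l A t r j' i') =
          card (cell p k q l A t r j' i) + card (cell p k q l A t r j i')" by simp
    qed
  qed
  thus ?thesis by blast
qed

section \<open>Counting in digit classes\<close>

lemma dig_less: "p > 0 \<Longrightarrow> dig p k n < p"
  by (simp add: dig_def)

lemma dig_mod_power: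
  assumes "k' < k" "p > 0"
  shows "dig p k' (n mod p ^ k) = dig p k' n"
proof -
  obtain d where k: "k = k' + Suc d" using assms(1) less_iff_Suc_add by auto
  have "p ^ k * (n div p ^ k) = p ^ k' * (p * (p ^ d * (n div p ^ k)))"
    unfolding k power_add power_Suc by (simp only: mult.assoc)
  hence "n div p ^ k' = (n mod p ^ k + p ^ k' * (p * (p ^ d * (n div p ^ k)))) div p ^ k'"
    by (metis mod_mult_div_eq)
  also have "\<dots> = (n mod p ^ k) div p ^ k' + p * (p ^ d * (n div p ^ k))"
    using assms by simp
  finally show ?thesis by (simp add: dig_def)
qed

text \<open>A lower digit is determined by \<open>n mod p ^ k\<close>, so restricting it keeps each
  residue class either whole or not at all. The same reason gives
  \<open>bal_restrict\<close>.\<close>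

lemma unif_restrict:
  assumes "unif p k A" "k' < k" "p > 0"
  shows "unif p k {n\<in>A. dig p k' n = c}"
  unfolding unif_def
proof (intro allI impI)
  fix r i i' assume "i < p" "i' < p"
  have "{n \<in> {n\<in>A. dig p k' n = c}. n mod p ^ k = r \<and> dig p k n = i} =
      (if dig p k' r = c then {n\<in>A. n mod p ^ k = r \<and> dig p k n = i} else {})" for i
    using dig_mod_power[OF assms(2,3)] by auto
  thus "card {n \<in> {n\<in>A. dig p k' n = c}. n mod p ^ k = r \<and> dig p k n = i} =
      card {n \<in> {n\<in>A. dig p k' n = c}. n mod p ^ k = r \<and> dig p k n = i'}"
    using unifD[OF assms(1) \<open>i < p\<close> \<open>i' < p\<close>] by simp
qed

lemma bal_restrict:
  assumes "bal p k q l A" "k' < k" "p > 0"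
  shows "bal p k q l {n\<in>A. dig p k' n = c}"
proof -
  have "cell p k q l {n\<in>A. dig p k' n = c} r t i j =
      (if dig p k' r = c then cell p k q l A r t i j else {})" for r t i j
    using dig_mod_power[OF assms(2,3)] by (auto simp: cell_def)
  thus ?thesis using assms(1) by (auto simp: bal_def)
qed

lemma card_fibers:
  assumes "finite A" "finite T" "f ` A \<subseteq> T"
  shows "card {n\<in>A. P n} = (\<Sum>r\<in>T. card {n\<in>A. f n = r \<and> P n})"
proof -
  have "(\<Sum>r\<in>T. sum (\<lambda>_. 1) {n\<in>{n\<in>A. P n}. f n = r}) = sum (\<lambda>_. 1::nat) {n\<in>A. P n}"
    by (rule sum.group) (use assms in auto)
  moreover have "{n\<in>{n\<in>A. P n}. f n = r} = {n\<in>A. f n = r \<and> P n}" for r by auto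
  ultimately show ?thesis by simp
qed

lemma card_dig_sum:
  assumes "finite A" "p > 0"
  shows "card {n\<in>A. P n} = (\<Sum>i<p. card {n\<in>A. dig p k n = i \<and> P n})"
  by (rule card_fibers) (use assms dig_less in auto)

lemma unif_card:
  assumes "unif p k A" "finite A" "c < p"
  shows "card A = p * card {n\<in>A. dig p k n = c}"
proof -
  have "card {n\<in>A. dig p k n = i} = card {n\<in>A. dig p k n = c}" if "i < p" for i
  proof -
    have s: "card {n\<in>A. dig p k n = i} = (\<Sum>r\<in>(\<lambda>n. n mod p ^ k) ` A. card {n\<in>A. n mod p ^ k = r \<and> dig p k n = i})" for i
      by (rule card_fibers) (use assms in auto)
    show ?thesis unfolding s using assms that by (intro sum.cong refl unifD)
  qed
  moreover have "card {n\<in>A. True} = (\<Sum>i<p. card {n\<in>A. dig p k n = i \<and> True})"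
    by (rule card_dig_sum) (use assms in auto)
  ultimately show ?thesis by simp
qed

text \<open>Peel off the least position: the elements with digit 0 there make up exactly one
  \<open>p\<close>-th of \<open>A\<close> and remain uniform at all higher positions.\<close>

lemma unif_dvd:
  assumes "finite K" "\<forall>k\<in>K. unif p k A" "finite A" "p > 0"
  shows "p ^ card K dvd card A"
  using assms
proof (induction "card K" arbitrary: K A)
  case 0 thus ?case by simp
next
  case (Suc m)
  define k where "k = Min K"
  have "K \<noteq> {}" using Suc.hyps(2) by auto
  hence K: "K \<noteq> {}" "k \<in> K" unfolding k_def using Suc.prems(1) by auto
  define B where "B = {n\<in>A. dig p k n = 0}"
  have "unif p k' B" if "k' \<in> K - {k}" for k'
  proof -
    have "k < k'" using that Suc.prems(1) K by (auto simp: k_def order.not_eq_order_implies_strict)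
    thus ?thesis unfolding B_def using that Suc.prems by (intro unif_restrict) auto
  qed
  hence "p ^ card (K - {k}) dvd card B"
    using Suc.hyps(2) K Suc.prems by (intro Suc.hyps(1)) (auto simp: B_def)
  moreover have "card A = p * card B"
    unfolding B_def using Suc.prems K by (intro unif_card) auto
  moreover have "card K = Suc (card (K - {k}))"
    using K Suc.prems by (metis card_Suc_Diff1)
  ultimately show ?case by simp
qed

text \<open>Uniformity is an equality of counts, hence passes to disjoint unions.\<close>

lemma unif_of_restrict:
  assumes "\<And>c. c < p \<Longrightarrow> unif q l {n\<in>A. dig p k n = c}" "finite A" "p > 0"
  shows "unif q l A"
  unfolding unif_def
proof (intro allI impI)
  fix r i i' assume ii: "i < q" "i' < q"
  have e: "{n\<in>A. dig p k n = c \<and> n mod q ^ l = r \<and> dig q l n = i} =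
     {n\<in>{n\<in>A. dig p k n = c}. n mod q ^ l = r \<and> dig q l n = i}" for c i by auto
  show "card {n\<in>A. n mod q ^ l = r \<and> dig q l n = i} = card {n\<in>A. n mod q ^ l = r \<and> dig q l n = i'}"
    unfolding card_dig_sum[OF assms(2,3), of "\<lambda>n. n mod q ^ l = r \<and> dig q l n = i" k]
      card_dig_sum[OF assms(2,3), of "\<lambda>n. n mod q ^ l = r \<and> dig q l n = i'" k] e
    using assms(1) ii by (intro sum.cong refl unifD) auto
qed

text \<open>If uniformity fails, then for some \<open>r\<close> and \<open>t\<close> a cell with
  \<open>p\<close>-digit \<open>i\<close> is larger than its counterpart with \<open>i'\<close>. By
  balance the difference is the same for every \<open>q\<close>-digit, so none of these cells with
  \<open>p\<close>-digit \<open>i\<close> is empty.\<close>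

lemma bal_cases:
  assumes "bal p k q l A" "finite A" "p > 0" "q > 0"
  shows "unif p k A \<or> (\<forall>j<q. \<exists>n\<in>A. dig q l n = j)"
proof (cases "unif p k A")
  case False
  let ?c = "\<lambda>r i. card {n\<in>A. n mod p ^ k = r \<and> dig p k n = i}"
  obtain r i i' where i: "i < p" "i' < p" "?c r i > ?c r i'"
  proof -
    obtain r i i' where "i < p" "i' < p" "?c r i \<noteq> ?c r i'"
      using False unfolding unif_def by blast
    thus ?thesis using that[of i i' r] that[of i' i r] by linarith
  qed
  let ?T = "(\<lambda>n. (n mod q ^ l, dig q l n)) ` A"
  have eq: "?c r i = (\<Sum>s\<in>?T. card (cell p k q l A r (fst s) i (snd s)))" for i
  proof -
    have "?c r i = (\<Sum>s\<in>?T. card {n\<in>A. (n mod q ^ l, dig q l n) = s \<and> n mod p ^ k = r \<and> dig p k n = i})"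
      by (rule card_fibers) (use assms in auto)
    also have "\<dots> = (\<Sum>s\<in>?T. card (cell p k q l A r (fst s) i (snd s)))"
      by (intro sum.cong arg_cong[where f = card]) (auto simp: cell_def)
    finally show ?thesis .
  qed
  have "\<exists>s\<in>?T. card (cell p k q l A r (fst s) i (snd s)) > card (cell p k q l A r (fst s) i' (snd s))"
  proof (rule ccontr)
    assume "\<not> ?thesis"
    hence "?c r i \<le> ?c r i'" unfolding eq by (intro sum_mono) auto
    thus False using i by simp
  qed
  then obtain t j where tj: "j < q" "card (cell p k q l A r t i j) > card (cell p k q l A r t i' j)"
    using dig_less[OF assms(4)] by fastforce
  have "\<exists>n\<in>A. dig q l n = j'" if "j' < q" for j'
  proof -
    have "card (cell p k q l A r t i j) + card (cell p k q l A r t i' j') =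
     card (cell p k q l A r t i j') + card (cell p k q l A r t i' j)"
      using assms(1) i tj that by (intro balD)
    hence "card (cell p k q l A r t i j') \<noteq> 0" using tj by linarith
    hence "cell p k q l A r t i j' \<noteq> {}" by (metis card.empty)
    thus ?thesis by (auto simp: cell_def)
  qed
  thus ?thesis by blast
qed simp

section \<open>Matrices of counts and lower bounds for the size\<close>

lemma additive_matrix:
  fixes c :: "nat \<Rightarrow> nat \<Rightarrow> nat"
  assumes "\<And>i i' j j'. i < p \<Longrightarrow> i' < p \<Longrightarrow> j < q \<Longrightarrow> j' < q \<Longrightarrow> c i j + c i' j' = c i j' + c i' j"
    and "p > 0" "q > 0"
  obtains u v j0 where "\<And>i j. i < p \<Longrightarrow> j < q \<Longrightarrow> c i j = u i + v j" "j0 < q" "v j0 = 0"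
proof -
  \<comment> \<open>A minimum of row 0 is taken so that \<open>c 0 j - c 0 j0\<close>, the later
    \<open>v j\<close>, is an exact difference of naturals.\<close>
  have "\<exists>j0. j0 < q \<and> (\<forall>j. j < q \<longrightarrow> c 0 j0 \<le> c 0 j)"
    using ex_has_least_nat[of "\<lambda>j. j < q" 0 "c 0"] assms(3) by auto
  then obtain j0 where j0: "j0 < q" "\<And>j. j < q \<Longrightarrow> c 0 j0 \<le> c 0 j" by blast
  have "c i j = c i j0 + (c 0 j - c 0 j0)" if "i < p" "j < q" for i j
    using assms(1)[of i 0 j j0] j0(1) j0(2)[of j] that assms(2) by linarith
  thus ?thesis using j0(1) by (rule that[of "\<lambda>i. c i j0" "\<lambda>j. c 0 j - c 0 j0"]) simp_all
qed

lemma matrix_sum: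
  fixes c :: "nat \<Rightarrow> nat \<Rightarrow> nat"
  assumes "\<And>i j. i < p \<Longrightarrow> j < q \<Longrightarrow> c i j = u i + v j"
  shows "(\<Sum>i<p. \<Sum>j<q. c i j) = q * (\<Sum>i<p. u i) + p * (\<Sum>j<q. v j)"
  using assms by (simp add: sum.distrib sum_distrib_left)

text \<open>
  With \<open>c i j = u i + v j\<close> and \<open>v j0 = 0\<close>, the sum over \<open>i\<close> at \<open>j0\<close> gives \<open>q dvd (\<Sum>i<p. u i)\<close>, hence
  \<open>v j = q * v' j\<close>; then \<open>p\<close> divides each \<open>u i + V\<close> with \<open>V = (\<Sum>j<q. v' j)\<close>, and the total is
  \<open>q * (\<Sum>i<p. u i + V)\<close>.
\<close>

lemma additive_matrix_bound:
  fixes c :: "nat \<Rightarrow> nat \<Rightarrow> nat"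
  assumes "\<And>i i' j j'. i < p \<Longrightarrow> i' < p \<Longrightarrow> j < q \<Longrightarrow> j' < q \<Longrightarrow> c i j + c i' j' = c i j' + c i' j"
    and "\<And>j. j < q \<Longrightarrow> q dvd (\<Sum>i<p. c i j)"
    and "\<And>i. i < p \<Longrightarrow> p dvd (\<Sum>j<q. c i j)"
    and "(\<Sum>i<p. \<Sum>j<q. c i j) > 0" "coprime p q" "p > 0" "q > 0"
  shows "p ^ 2 * q \<le> (\<Sum>i<p. \<Sum>j<q. c i j) \<or> p * q ^ 2 \<le> (\<Sum>i<p. \<Sum>j<q. c i j)"
proof -
  obtain u v j0 where uv: "\<And>i j. i < p \<Longrightarrow> j < q \<Longrightarrow> c i j = u i + v j" and j0: "j0 < q" "v j0 = 0"
    using assms(1,6,7) by (rule additive_matrix) blast+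
  have row: "(\<Sum>i<p. c i j) = (\<Sum>i<p. u i) + p * v j" if "j < q" for j
    using that uv by (simp add: sum.distrib)
  have qU: "q dvd (\<Sum>i<p. u i)" using assms(2)[OF j0(1)] row[OF j0(1)] j0(2) by simp
  have "q dvd v j" if "j < q" for j
  proof -
    have "q dvd p * v j" using assms(2)[OF that] qU by (simp add: row[OF that] dvd_add_right_iff)
    thus ?thesis using assms(5) by (simp add: coprime_dvd_mult_right_iff coprime_commute)
  qed
  then have "\<exists>v'. \<forall>j<q. v j = q * v' j" unfolding dvd_def by metis
  then obtain v' where v': "\<And>j. j < q \<Longrightarrow> v j = q * v' j" by blast
  define V where "V = (\<Sum>j<q. v' j)"
  have sv: "(\<Sum>j<q. v j) = q * V" using v' by (simp add: V_def sum_distrib_left)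
  have tot: "(\<Sum>i<p. \<Sum>j<q. c i j) = q * (\<Sum>i<p. u i) + p * (q * V)"
    using matrix_sum[OF uv] by (simp add: sv)
  have pu: "p dvd u i + V" if "i < p" for i
  proof -
    have "(\<Sum>j<q. c i j) = q * (u i + V)"
      using uv that sv by (simp add: sum.distrib algebra_simps)
    thus ?thesis using assms(3)[OF that] assms(5) by (simp add: coprime_dvd_mult_right_iff)
  qed
  show ?thesis
  \<comment> \<open>For \<open>V = 0\<close> the sum of the \<open>u i\<close> is a positive
    multiple of \<open>p * q\<close>, which gives \<open>p * q ^ 2\<close>. Otherwise each
    \<open>u i + V\<close> is a positive multiple of \<open>p\<close>, which gives
    \<open>p ^ 2 * q\<close>.\<close>
  proof (cases "V = 0")
    case True
    have "p dvd (\<Sum>i<p. u i)" using pu True by (intro dvd_sum) auto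
    hence "p * q dvd (\<Sum>i<p. u i)" using qU assms(5) by (intro divides_mult) auto
    moreover have "(\<Sum>i<p. u i) > 0" using tot True assms(4) by simp
    ultimately have "p * q \<le> (\<Sum>i<p. u i)" by (intro dvd_imp_le)
    hence "q * (p * q) \<le> q * (\<Sum>i<p. u i)" by (rule mult_left_mono) simp
    thus ?thesis using tot True by (simp add: power2_eq_square mult_ac)
  next
    case False
    have "p \<le> u i + V" if "i < p" for i using pu[OF that] False by (intro dvd_imp_le) auto
    hence "(\<Sum>i<p. p) \<le> (\<Sum>i<p. u i + V)" by (intro sum_mono) auto
    hence "q * (p * p) \<le> q * ((\<Sum>i<p. u i) + p * V)" by (simp add: sum.distrib)
    thus ?thesis using tot by (simp add: power2_eq_square algebra_simps)
  qed
qed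

text \<open>Balance is linear in the counts, so summing over the residues \<open>r\<close> modulo
  \<open>p ^ k\<close> removes that constraint; \<open>bal_collapse2\<close> then sums over
  \<open>t\<close> as well.\<close>

lemma bal_collapse:
  assumes "bal p k q l A" "finite A" "i < p" "i' < p" "j < q" "j' < q"
  shows "card {n\<in>A. dig p k n = i \<and> n mod q ^ l = t \<and> dig q l n = j} +
         card {n\<in>A. dig p k n = i' \<and> n mod q ^ l = t \<and> dig q l n = j'} =
         card {n\<in>A. dig p k n = i \<and> n mod q ^ l = t \<and> dig q l n = j'} +
         card {n\<in>A. dig p k n = i' \<and> n mod q ^ l = t \<and> dig q l n = j}"
proof -
  have c: "card {n\<in>A. dig p k n = i \<and> n mod q ^ l = t \<and> dig q l n = j} =
     (\<Sum>r\<in>(\<lambda>n. n mod p ^ k) ` A. card (cell p k q l A r t i j))" for i j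
    unfolding cell_def by (rule card_fibers) (use assms in auto)
  show ?thesis unfolding c sum.distrib[symmetric]
    using assms by (intro sum.cong refl balD)
qed

lemma bal_collapse2:
  assumes "bal p k q l A" "finite A" "i < p" "i' < p" "j < q" "j' < q"
  shows "card {n\<in>A. dig p k n = i \<and> dig q l n = j} + card {n\<in>A. dig p k n = i' \<and> dig q l n = j'} =
         card {n\<in>A. dig p k n = i \<and> dig q l n = j'} + card {n\<in>A. dig p k n = i' \<and> dig q l n = j}"
proof -
  have c: "card {n\<in>A. dig p k n = i \<and> dig q l n = j} =
     (\<Sum>t\<in>(\<lambda>n. n mod q ^ l) ` A. card {n\<in>A. dig p k n = i \<and> n mod q ^ l = t \<and> dig q l n = j})" for i j
  proof -
    have "card {n\<in>A. dig p k n = i \<and> dig q l n = j} =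
      (\<Sum>t\<in>(\<lambda>n. n mod q ^ l) ` A. card {n\<in>A. n mod q ^ l = t \<and> dig p k n = i \<and> dig q l n = j})"
      by (rule card_fibers) (use assms in auto)
    thus ?thesis by (simp add: conj_left_commute)
  qed
  show ?thesis unfolding c sum.distrib[symmetric]
    using assms by (intro sum.cong refl bal_collapse)
qed

text \<open>For each residue \<open>t\<close> the counts have the form \<open>u t i + v t j\<close>.
  Summation gives \<open>card A = q * U + p * V\<close>, hence \<open>q\<close> divides
  \<open>V\<close>, while \<open>p * V < p * q\<close>. So \<open>V = 0\<close>, every
  \<open>v\<close> vanishes, and the counts do not depend on the \<open>q\<close>-digit.\<close>

lemma bal_small_unif:
  assumes "bal p k q l A" "finite A" "q dvd card A" "card A < p * q" "coprime p q" "p > 0" "q > 0"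
  shows "unif q l A"
proof -
  define c where "c t i j = card {n\<in>A. dig p k n = i \<and> n mod q ^ l = t \<and> dig q l n = j}" for t i j
  have "\<exists>u v. \<forall>i<p. \<forall>j<q. c t i j = u i + v j" for t
  proof -
    have "c t i j + c t i' j' = c t i j' + c t i' j" if "i < p" "i' < p" "j < q" "j' < q" for i i' j j'
      unfolding c_def using that by (intro bal_collapse[OF assms(1,2)])
    then obtain u v where "\<And>i j. i < p \<Longrightarrow> j < q \<Longrightarrow> c t i j = u i + v j"
      using assms(6,7) by (rule additive_matrix) blast+
    thus ?thesis by blast
  qed
  then obtain u v where uv: "\<And>t i j. i < p \<Longrightarrow> j < q \<Longrightarrow> c t i j = u t i + v t j"
    by metis
  define T where "T = (\<lambda>n. n mod q ^ l) ` A"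
  have "card A = (\<Sum>t\<in>T. \<Sum>i<p. \<Sum>j<q. c t i j)"
  proof -
    have "card {n\<in>A. True} = (\<Sum>t\<in>T. card {n\<in>A. n mod q ^ l = t \<and> True})"
      by (rule card_fibers) (use assms in \<open>auto simp: T_def\<close>)
    also have "\<dots> = (\<Sum>t\<in>T. \<Sum>i<p. \<Sum>j<q. c t i j)"
    proof (intro sum.cong refl)
      fix t
      have "card {n\<in>A. n mod q ^ l = t \<and> True} = (\<Sum>i<p. card {n\<in>A. dig p k n = i \<and> n mod q ^ l = t})"
        using card_dig_sum[OF assms(2,6), of "\<lambda>n. n mod q ^ l = t" k] by simp
      also have "\<dots> = (\<Sum>i<p. \<Sum>j<q. c t i j)"
      proof (intro sum.cong refl)
        fix i
        have "card {n\<in>A. dig p k n = i \<and> n mod q ^ l = t} =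
          (\<Sum>j<q. card {n\<in>A. dig q l n = j \<and> dig p k n = i \<and> n mod q ^ l = t})"
          by (rule card_dig_sum) (use assms in auto)
        also have "\<dots> = (\<Sum>j<q. c t i j)"
          unfolding c_def by (intro sum.cong arg_cong[where f = card]) auto
        finally show "card {n\<in>A. dig p k n = i \<and> n mod q ^ l = t} = (\<Sum>j<q. c t i j)" .
      qed
      finally show "card {n\<in>A. n mod q ^ l = t \<and> True} = (\<Sum>i<p. \<Sum>j<q. c t i j)" .
    qed
    finally show ?thesis by simp
  qed
  also have "\<dots> = (\<Sum>t\<in>T. q * (\<Sum>i<p. u t i) + p * (\<Sum>j<q. v t j))"
    using matrix_sum[OF uv] by simp
  also have "\<dots> = q * (\<Sum>t\<in>T. \<Sum>i<p. u t i) + p * (\<Sum>t\<in>T. \<Sum>j<q. v t j)"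
    by (simp add: sum.distrib sum_distrib_left)
  finally have A: "card A = q * (\<Sum>t\<in>T. \<Sum>i<p. u t i) + p * (\<Sum>t\<in>T. \<Sum>j<q. v t j)" .
  have "q dvd p * (\<Sum>t\<in>T. \<Sum>j<q. v t j)"
    using assms(3) unfolding A by (simp add: dvd_add_right_iff)
  hence qV: "q dvd (\<Sum>t\<in>T. \<Sum>j<q. v t j)"
    using assms(5) by (simp add: coprime_dvd_mult_right_iff coprime_commute)
  have "p * (\<Sum>t\<in>T. \<Sum>j<q. v t j) < p * q" using A assms(4) by linarith
  hence "(\<Sum>t\<in>T. \<Sum>j<q. v t j) = 0" using qV dvd_imp_le by fastforce
  hence v0: "v t j = 0" if "t \<in> T" "j < q" for t j
    using that assms(2) sum_eq_0_iff[of T] by (auto simp: T_def)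
  show ?thesis unfolding unif_def
  proof (intro allI impI)
    fix t j j' assume jj: "j < q" "j' < q"
    have e: "card {n\<in>A. n mod q ^ l = t \<and> dig q l n = j} = (\<Sum>i<p. c t i j)" for j
      unfolding c_def by (rule card_dig_sum) (use assms in auto)
    have "c t i j = c t i j'" if "i < p" for i
    \<comment> \<open>The vanishing of \<open>v\<close> is known only for residues that occur in
      \<open>A\<close>; for the others all counts are 0.\<close>
    proof (cases "t \<in> T")
      case True thus ?thesis using v0 uv jj that by simp
    next
      case False
      hence "c t i j = 0" for j unfolding c_def T_def using assms(2) by (auto simp: card_eq_0_iff)
      thus ?thesis by simp
    qed
    thus "card {n\<in>A. n mod q ^ l = t \<and> dig q l n = j} = card {n\<in>A. n mod q ^ l = t \<and> dig q l n = j'}"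
      unfolding e by (intro sum.cong) auto
  qed
qed

text \<open>If a class of the digit at \<open>k1\<close> has at least \<open>p * q\<close> elements,
  uniformity multiplies this by \<open>p\<close>. Otherwise \<open>bal_small_unif\<close> applies to
  every class, so \<open>A\<close> is uniform at \<open>l\<close> as well as at \<open>l2\<close>,
  and \<open>p * q ^ 2\<close> divides its size.\<close>

lemma three_scales_least_digit:
  assumes "unif p k1 A" "unif q l2 A" "bal p k q l A" "k1 < k" "l \<noteq> l2"
    and "finite A" "A \<noteq> {}" "coprime p q" "p > 0" "q > 0"
  shows "p ^ 2 * q \<le> card A \<or> p * q ^ 2 \<le> card A"
proof (cases "\<exists>c<p. card {n\<in>A. dig p k1 n = c} \<ge> p * q")
  case True
  then obtain c where c: "c < p" "card {n\<in>A. dig p k1 n = c} \<ge> p * q" by blast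
  hence "card A \<ge> p * (p * q)" using unif_card[OF assms(1,6) c(1)] by simp
  thus ?thesis by (simp add: power2_eq_square mult_ac)
next
  case False
  have q1: "q dvd card A" using unif_dvd[of "{l2}" q A] assms by simp
  have "unif q l {n\<in>A. dig p k1 n = c}" if "c < p" for c
  proof (rule bal_small_unif)
    show "bal p k q l {n \<in> A. dig p k1 n = c}" using assms by (intro bal_restrict) auto
    show "q dvd card {n \<in> A. dig p k1 n = c}"
      using q1 unif_card[OF assms(1,6) that] assms(8)
      by (simp add: coprime_dvd_mult_right_iff coprime_commute)
  qed (use False that assms in \<open>auto simp: not_le\<close>)
  hence "unif q l A" using assms by (intro unif_of_restrict[of p q l A k1]) auto
  hence "q ^ card {l, l2} dvd card A" using assms by (intro unif_dvd) auto
  moreover have "card {l, l2} = 2" using assms(5) by simp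
  moreover have "p dvd card A" using unif_dvd[of "{k1}" p A] assms by simp
  ultimately have "p * q ^ 2 dvd card A" using assms(8) by (intro divides_mult) simp_all
  moreover have "card A > 0" using assms by (simp add: card_gt_0_iff)
  ultimately show ?thesis by (blast dest: dvd_imp_le)
qed

lemma three_scales:
  assumes "unif p k1 A" "unif q l2 A" "bal p k q l A" "k \<noteq> k1" "l \<noteq> l2"
    and "finite A" "A \<noteq> {}" "coprime p q" "p > 0" "q > 0"
  shows "p ^ 2 * q \<le> card A \<or> p * q ^ 2 \<le> card A"
proof -
  consider "k1 < k" | "l2 < l" | "k < k1" "l < l2" using assms(4,5) by linarith
  thus ?thesis
  proof cases
    case 1 thus ?thesis using three_scales_least_digit assms by blast
  next
    case 2
    hence "q ^ 2 * p \<le> card A \<or> q * p ^ 2 \<le> card A"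
      using assms by (intro three_scales_least_digit[of q l2 A p k1 l k]) (auto simp: bal_commute coprime_commute)
    thus ?thesis by (auto simp: mult_ac)
  next
    case 3
    \<comment> \<open>Both digits of the mixed scale lie below the uniform ones. Fixing either of
      them therefore preserves uniformity, which makes the row and column sums divisible by
      \<open>p\<close> and \<open>q\<close> as \<open>additive_matrix_bound\<close>
      requires.\<close>
    define c where "c i j = card {n\<in>A. dig p k n = i \<and> dig q l n = j}" for i j
    have col: "(\<Sum>j<q. c i j) = card {n\<in>A. dig p k n = i}" for i
      using card_dig_sum[OF assms(6,10), of "\<lambda>n. dig p k n = i" l] by (simp add: c_def conj_commute)
    have row: "(\<Sum>i<p. c i j) = card {n\<in>A. dig q l n = j}" for j
      using card_dig_sum[OF assms(6,9), of "\<lambda>n. dig q l n = j" k] by (simp add: c_def)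
    have tot: "(\<Sum>i<p. \<Sum>j<q. c i j) = card A"
      using card_dig_sum[OF assms(6,9), of "\<lambda>n. True" k] by (simp add: col)
    have "unif p k1 {n\<in>A. dig p k n = i}" for i using unif_restrict assms(1,9) 3 by blast
    hence "p dvd (\<Sum>j<q. c i j)" for i
      unfolding col using unif_dvd[of "{k1}" p "{n\<in>A. dig p k n = i}"] assms by simp
    moreover have "unif q l2 {n\<in>A. dig q l n = j}" for j using unif_restrict assms(2,10) 3 by blast
    hence "q dvd (\<Sum>i<p. c i j)" for j
      unfolding row using unif_dvd[of "{l2}" q "{n\<in>A. dig q l n = j}"] assms by simp
    moreover have "card A > 0" using assms by (simp add: card_gt_0_iff)
    ultimately show ?thesis
      using additive_matrix_bound[of p q c] bal_collapse2[OF assms(3,6)] assms tot unfolding c_def by simp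
  qed
qed


subsection \<open>Covers\<close>

text \<open>The pair \<open>(a, b)\<close> encodes the scale \<open>p ^ a * q ^ b\<close>; exponent
  \<open>Suc k\<close> belongs to the digit at position \<open>k\<close>. The pair
  \<open>(0, 0)\<close> is the scale 1 and gets a default value.\<close>

fun scale_cond :: "nat \<Rightarrow> nat \<Rightarrow> nat set \<Rightarrow> nat \<times> nat \<Rightarrow> bool" where
  "scale_cond p q A (0, 0) = True"
| "scale_cond p q A (Suc k, 0) = unif p k A"
| "scale_cond p q A (0, Suc l) = unif q l A"
| "scale_cond p q A (Suc k, Suc l) = bal p k q l A"

lemma scale_cond_swap: "scale_cond q p A (prod.swap s) = scale_cond p q A s"
  by (cases "(p, q, A, s)" rule: scale_cond.cases) (simp_all add: bal_commute)

text \<open>Here \<open>m\<close> is compared with the size of the fibered set that the cover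
  yields. Exponent 0 is excluded because fibering in direction \<open>p\<close> needs a scale
  divisible by \<open>p\<close>.\<close>

definition cover_bound :: "nat \<Rightarrow> nat \<Rightarrow> (nat \<times> nat) set \<Rightarrow> nat \<Rightarrow> bool" where
  "cover_bound p q S m \<longleftrightarrow> (\<exists>E F. finite E \<and> finite F \<and> 0 \<notin> E \<and> 0 \<notin> F \<and>
     (\<forall>s\<in>S. fst s \<in> E \<or> snd s \<in> F) \<and> p ^ card E * q ^ card F \<le> m)"

lemma cover_boundI:
  assumes "finite E" "finite F" "0 \<notin> E" "0 \<notin> F" "\<And>s. s \<in> S \<Longrightarrow> fst s \<in> E \<or> snd s \<in> F"
    "p ^ card E * q ^ card F \<le> m"
  shows "cover_bound p q S m"
  using assms unfolding cover_bound_def by blast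

lemma cover_bound_swap:
  assumes "cover_bound p q S m"
  shows "cover_bound q p (prod.swap ` S) m"
proof -
  obtain E F where EF: "finite E" "finite F" "0 \<notin> E" "0 \<notin> F"
     "\<forall>s\<in>S. fst s \<in> E \<or> snd s \<in> F" "p ^ card E * q ^ card F \<le> m"
    using assms unfolding cover_bound_def by blast
  have "\<forall>s\<in>prod.swap ` S. fst s \<in> F \<or> snd s \<in> E" using EF(5) by auto
  thus ?thesis unfolding cover_bound_def using EF by (metis mult.commute)
qed

text \<open>Since 0 is not in \<open>F\<close>, the pair \<open>(a, 0)\<close> can only be covered
  by \<open>a \<in> E\<close>, and this covers \<open>(a, b)\<close> too.\<close>

lemma cover_bound_replace:
  assumes "cover_bound p q (insert (a, 0) (S - {(a, b)})) m"
  shows "cover_bound p q S m"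
proof -
  obtain E F where EF: "finite E" "finite F" "0 \<notin> E" "0 \<notin> F"
     "\<forall>s\<in>insert (a, 0) (S - {(a, b)}). fst s \<in> E \<or> snd s \<in> F" "p ^ card E * q ^ card F \<le> m"
    using assms unfolding cover_bound_def by blast
  have "a \<in> E" using EF(4,5) by auto
  hence "\<forall>s\<in>S. fst s \<in> E \<or> snd s \<in> F" using EF(5) by fastforce
  thus ?thesis unfolding cover_bound_def using EF by blast
qed

lemma cover_bound_replace':
  assumes "cover_bound p q (insert (0, b) (S - {(a, b)})) m"
  shows "cover_bound p q S m"
proof -
  have "cover_bound q p (insert (b, 0) (prod.swap ` S - {(b, a)})) m"
    using cover_bound_swap[OF assms] by (simp add: image_set_diff inj_on_def)
  hence "cover_bound q p (prod.swap ` S) m" by (rule cover_bound_replace)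
  thus ?thesis using cover_bound_swap by (fastforce simp: image_image)
qed

text \<open>The smallest class of the digit at \<open>k\<close> has at most one \<open>p\<close>-th
  of the elements of \<open>A\<close> and keeps all conditions with larger first exponent. Adding
  \<open>Suc k\<close> to \<open>E\<close> covers the remaining scales at the cost of a factor
  \<open>p\<close>.\<close>

lemma cover_bound_least:
  assumes "\<And>B. finite B \<Longrightarrow> B \<noteq> {} \<Longrightarrow> \<forall>s\<in>{s\<in>S. fst s \<noteq> Suc k}. scale_cond p q B s \<Longrightarrow>
      cover_bound p q {s\<in>S. fst s \<noteq> Suc k} (card B)"
    and "\<forall>s\<in>S. Suc k \<le> fst s" "\<forall>s\<in>S. scale_cond p q A s"
    and "\<forall>i<p. \<exists>n\<in>A. dig p k n = i" "finite A" "p > 0"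
  shows "cover_bound p q S (card A)"
proof -
  define B where "B i = {n\<in>A. dig p k n = i}" for i
  obtain c where c: "c < p" "\<And>i. i < p \<Longrightarrow> card (B c) \<le> card (B i)"
    using ex_has_least_nat[of "\<lambda>i. i < p" 0 "\<lambda>i. card (B i)"] assms(6) by auto
  have "scale_cond p q (B c) s" if "s \<in> S" "fst s \<noteq> Suc k" for s
  proof -
    have "scale_cond p q A s" "Suc k < fst s" using that assms(2,3) by auto
    thus ?thesis unfolding B_def using assms(6)
      by (cases "(p, q, A, s)" rule: scale_cond.cases) (auto intro: unif_restrict bal_restrict)
  qed
  hence "cover_bound p q {s\<in>S. fst s \<noteq> Suc k} (card (B c))"
    using assms(4,5) c by (intro assms(1)) (auto simp: B_def)
  then obtain E F where EF: "finite E" "finite F" "0 \<notin> E" "0 \<notin> F"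
     "\<forall>s\<in>{s\<in>S. fst s \<noteq> Suc k}. fst s \<in> E \<or> snd s \<in> F" "p ^ card E * q ^ card F \<le> card (B c)"
    unfolding cover_bound_def by blast
  have "card A = (\<Sum>i<p. card (B i))"
    using card_dig_sum[OF assms(5,6), of "\<lambda>_. True" k] by (simp add: B_def)
  also have "\<dots> \<ge> (\<Sum>i<p. card (B c))" using c by (intro sum_mono) auto
  finally have "card A \<ge> p * card (B c)" by simp
  moreover have "p * (p ^ card E * q ^ card F) \<le> p * card (B c)"
    using EF(6) by (rule mult_le_mono2)
  moreover have "p ^ card (insert (Suc k) E) \<le> p ^ Suc (card E)"
    using assms(6) EF(1) by (intro power_increasing) (auto simp: card_insert_if)
  hence "p ^ card (insert (Suc k) E) * q ^ card F \<le> p * (p ^ card E * q ^ card F)"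
    by (metis mult.assoc mult_le_mono1 power_Suc)
  ultimately have "p ^ card (insert (Suc k) E) * q ^ card F \<le> card A" by linarith
  thus ?thesis using EF(1-5) by (intro cover_boundI[of "insert (Suc k) E" F]) blast+
qed

text \<open>All digit values at the least position occur: by uniformity if the scale attaining the
  minimum is pure, and by hypothesis if it is mixed.\<close>

lemma cover_bound_by_least:
  assumes "\<And>B. finite B \<Longrightarrow> B \<noteq> {} \<Longrightarrow> \<forall>s\<in>{s\<in>S. fst s \<noteq> Min (fst ` S)}. scale_cond p q B s \<Longrightarrow>
      cover_bound p q {s\<in>S. fst s \<noteq> Min (fst ` S)} (card B)"
    and "finite S" "S \<noteq> {}" "\<forall>s\<in>S. fst s > 0" "\<forall>s\<in>S. scale_cond p q A s"
    and "\<And>k l. (Suc k, Suc l) \<in> S \<Longrightarrow> \<forall>i<p. \<exists>n\<in>A. dig p k n = i"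
    and "finite A" "A \<noteq> {}" "p > 0"
  shows "cover_bound p q S (card A)"
proof -
  have fin: "finite (fst ` S)" "fst ` S \<noteq> {}" using assms(2,3) by auto
  obtain s where s: "s \<in> S" "fst s = Min (fst ` S)" using Min_in[OF fin] by auto
  then obtain k b where kb: "s = (Suc k, b)" using assms(4) by (metis gr0_implies_Suc prod.collapse)
  have "\<forall>i<p. \<exists>n\<in>A. dig p k n = i"
  proof (cases b)
    case 0
    have "scale_cond p q A s" using assms(5) s(1) by blast
    hence u: "unif p k A" by (simp add: kb 0)
    have "card A > 0" using assms(7,8) by (simp add: card_gt_0_iff)
    hence "{n\<in>A. dig p k n = i} \<noteq> {}" if "i < p" for i
      using unif_card[OF u assms(7) that] by (metis card.empty mult_0_right less_irrefl)
    thus ?thesis by blast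
  next
    case (Suc l) thus ?thesis using assms(6) s kb by blast
  qed
  moreover have "\<forall>s\<in>S. Suc k \<le> fst s" using s kb fin by (metis Min_le fst_conv imageI)
  ultimately show ?thesis using assms s kb by (intro cover_bound_least[of S k]) auto
qed

lemma cover_bound_card:
  assumes "finite S" "card S \<le> 3" "(0, 0) \<notin> S" "\<forall>s\<in>S. scale_cond p q A s"
    and "finite A" "A \<noteq> {}" "coprime p q" "p > 0" "q > 0"
  shows "cover_bound p q S (card A)"
  using assms(1-6)
\<comment> \<open>The measure counts mixed scales twice. It drops when a mixed scale is replaced by
  a pure one (\<open>dec\<close>) and when scales are removed (\<open>sub\<close>). \<open>A\<close>
  is generalized because the induction passes to digit classes.\<close>
proof (induction "card S + card {s\<in>S. fst s > 0 \<and> snd s > 0}" arbitrary: S A rule: less_induct)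
  case less
  let ?mix = "\<lambda>S. {s\<in>S. fst s > 0 \<and> snd s > 0} :: (nat \<times> nat) set"
  have dec: "card (insert t (S - {s})) + card (?mix (insert t (S - {s}))) < card S + card (?mix S) \<and>
      card (insert t (S - {s})) \<le> 3"
    if "s \<in> ?mix S" "fst t = 0 \<or> snd t = 0" for s t
  proof -
    have "card (insert t (S - {s})) \<le> Suc (card (S - {s}))" by (rule card_insert_le_m1) auto
    also have "\<dots> = card S" using that less.prems(1) by (intro card_Suc_Diff1) auto
    finally have "card (insert t (S - {s})) \<le> card S" .
    moreover have "?mix (insert t (S - {s})) \<subset> ?mix S" using that by auto
    hence "card (?mix (insert t (S - {s}))) < card (?mix S)"
      using less.prems(1) by (intro psubset_card_mono) auto
    ultimately show ?thesis using less.prems(2) by linarith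
  qed
  have sub: "cover_bound p q T (card B)" if "T \<subset> S" "finite B" "B \<noteq> {}" "\<forall>s\<in>T. scale_cond p q B s" for T B
  proof (rule less.hyps)
    have "card T < card S" using that less.prems(1) by (intro psubset_card_mono)
    moreover have "card (?mix T) \<le> card (?mix S)" using that less.prems(1) by (intro card_mono) auto
    ultimately show "card T + card (?mix T) < card S + card (?mix S)" "card T \<le> 3"
      using less.prems(2) by linarith+
    show "finite T" using that less.prems(1) by (meson finite_subset psubset_imp_subset)
  qed (use that less.prems in auto)
  consider (p) k l where "(Suc k, Suc l) \<in> S" "unif p k A"
    | (q) k l where "(Suc k, Suc l) \<in> S" "unif q l A"
    | (none) "\<And>k l. (Suc k, Suc l) \<in> S \<Longrightarrow> \<not> unif p k A \<and> \<not> unif q l A" by blast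
  thus ?case
  proof cases
    case p
    have "cover_bound p q (insert (Suc k, 0) (S - {(Suc k, Suc l)})) (card A)"
      using dec[of "(Suc k, Suc l)" "(Suc k, 0)"] less.prems p by (intro less.hyps) auto
    thus ?thesis by (rule cover_bound_replace)
  next
    case q
    have "cover_bound p q (insert (0, Suc l) (S - {(Suc k, Suc l)})) (card A)"
      using dec[of "(Suc k, Suc l)" "(0, Suc l)"] less.prems q by (intro less.hyps) auto
    thus ?thesis by (rule cover_bound_replace')
  next
    case none
    have occ: "(\<forall>i<p. \<exists>n\<in>A. dig p k n = i) \<and> (\<forall>j<q. \<exists>n\<in>A. dig q l n = j)" if "(Suc k, Suc l) \<in> S" for k l
    proof -
      have "bal p k q l A" using less.prems(4) that by force
      thus ?thesis using none[OF that] bal_cases[of p k q l A] bal_cases[of q l p k A]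
          less.prems(5) assms(8,9) by (auto simp: bal_commute)
    qed
    consider (pure) "?mix S = {}" | (fst) "S \<noteq> {}" "\<forall>s\<in>S. fst s > 0" | (snd) "S \<noteq> {}" "\<forall>s\<in>S. snd s > 0"
      | (three) k1 l2 k l where "(Suc k1, 0) \<in> S" "(0, Suc l2) \<in> S" "(Suc k, Suc l) \<in> S"
    proof -
      show thesis
      proof (cases "?mix S = {} \<or> (\<forall>s\<in>S. fst s > 0) \<or> (\<forall>s\<in>S. snd s > 0)")
        case True
        thus thesis using that(1-3) by (cases "S = {}") auto
      next
        case False
        then obtain s where "s \<in> S" "fst s > 0" "snd s > 0" by blast
        then obtain k l where "(Suc k, Suc l) \<in> S" by (metis gr0_implies_Suc prod.collapse)
        \<comment> \<open>As \<open>(0, 0)\<close> is not in \<open>S\<close>, the two scales with a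
          zero exponent are pure, one for each prime.\<close>
        moreover obtain b where "(0, b) \<in> S" using False by (metis neq0_conv prod.collapse)
        moreover obtain a where "(a, 0) \<in> S" using False by (metis neq0_conv prod.collapse)
        ultimately show thesis using that(4) less.prems(3) by (metis not0_implies_Suc)
      qed
    qed
    thus ?thesis
    proof cases
      case pure
      \<comment> \<open>All scales are pure, so their exponents form a cover, and divisibility by
        coprime prime powers pays for it.\<close>
      define K where "K = {k. (Suc k, 0) \<in> S}"
      define L where "L = {l. (0, Suc l) \<in> S}"
      have fin: "finite K" "finite L"
      proof -
        have "Suc ` K \<subseteq> fst ` S" "Suc ` L \<subseteq> snd ` S" by (force simp: K_def L_def)+
        thus "finite K" "finite L" using less.prems(1)
          by (meson finite_imageD finite_imageI finite_subset inj_Suc inj_on_subset subset_UNIV)+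
      qed
      have "p ^ card K dvd card A"
        using less.prems fin assms(8) by (intro unif_dvd) (force simp: K_def)+
      moreover have "q ^ card L dvd card A"
        using less.prems fin assms(9) by (intro unif_dvd) (force simp: L_def)+
      ultimately have "p ^ card K * q ^ card L dvd card A" using assms(7) by (intro divides_mult) auto
      moreover have "card A > 0" using less.prems by (simp add: card_gt_0_iff)
      ultimately have "p ^ card K * q ^ card L \<le> card A" by (rule dvd_imp_le)
      moreover have "fst s \<in> Suc ` K \<or> snd s \<in> Suc ` L" if "s \<in> S" for s
      proof -
        obtain a b where s: "s = (a, b)" by force
        show ?thesis using that pure less.prems(3) unfolding s K_def L_def
          by (cases a; cases b) auto
      qed
      ultimately show ?thesis using fin
        by (intro cover_boundI[of "Suc ` K" "Suc ` L"]) (auto simp: card_image)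
    next
      case fst
      have psub: "{s\<in>S. fst s \<noteq> Min (fst ` S)} \<subset> S"
      proof -
        have "Min (fst ` S) \<in> fst ` S" using fst(1) less.prems(1) by (intro Min_in) auto
        then obtain s where "s \<in> S" "fst s = Min (fst ` S)" by auto
        thus ?thesis by blast
      qed
      show ?thesis
      proof (rule cover_bound_by_least)
        show "cover_bound p q {s\<in>S. fst s \<noteq> Min (fst ` S)} (card B)"
          if "finite B" "B \<noteq> {}" "\<forall>s\<in>{s\<in>S. fst s \<noteq> Min (fst ` S)}. scale_cond p q B s" for B
          using psub that by (rule sub)
        show "\<forall>i<p. \<exists>n\<in>A. dig p k n = i" if "(Suc k, Suc l) \<in> S" for k l
          using occ[OF that] by blast
      qed (use fst less.prems assms(8) in blast)+
    next
      case snd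
      let ?S = "prod.swap ` S"
      have "cover_bound q p ?S (card A)"
      proof (rule cover_bound_by_least)
        fix B :: "nat set"
        let ?T = "{s\<in>?S. fst s \<noteq> Min (fst ` ?S)}"
        assume B: "finite B" "B \<noteq> {}" "\<forall>s\<in>?T. scale_cond q p B s"
        have "Min (fst ` ?S) \<in> fst ` ?S" using snd(1) less.prems(1) by (intro Min_in) auto
        then obtain s where "s \<in> ?S" "fst s = Min (fst ` ?S)" by auto
        hence "?T \<subset> ?S" by blast
        hence "prod.swap ` ?T \<subset> prod.swap ` ?S"
          using inj_image_subset_iff[OF inj_swap] unfolding psubset_eq inj_image_eq_iff[OF inj_swap] by blast
        hence "prod.swap ` ?T \<subset> S" by (simp add: image_image)
        hence "cover_bound p q (prod.swap ` ?T) (card B)"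
          using B by (intro sub) (auto simp: scale_cond_swap)
        thus "cover_bound q p ?T (card B)" using cover_bound_swap by (fastforce simp: image_image)
      qed (use snd less.prems occ assms(9) in \<open>auto simp: scale_cond_swap\<close>)
      thus ?thesis using cover_bound_swap by (fastforce simp: image_image)
    next
      case three
      \<comment> \<open>Here the bound of three on the number of scales enters: these three are
        distinct, so there are no others.\<close>
      have "{(Suc k1, 0), (0, Suc l2), (Suc k, Suc l)} = S"
        using three less.prems(1,2) by (intro card_seteq) auto
      hence S: "S = {(Suc k1, 0), (0, Suc l2), (Suc k, Suc l)}" ..
      have u: "unif p k1 A" "unif q l2 A" "bal p k q l A" using less.prems(4) unfolding S by auto
      have pos: "card A > 0" using less.prems by (simp add: card_gt_0_iff)
      show ?thesis
      \<comment> \<open>If a position coincides, the exponents of the pure scales already cover the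
        mixed one. Otherwise one further exponent is needed, and either bound of
        \<open>three_scales\<close> pays for it.\<close>
      proof (cases "k = k1 \<or> l = l2")
        case True
        have "p dvd card A" "q dvd card A"
          using unif_dvd[of "{k1}" p A] unif_dvd[of "{l2}" q A] u less.prems(5) assms(8,9) by auto
        hence "p * q dvd card A" using assms(7) by (intro divides_mult)
        hence "p * q \<le> card A" using pos by (rule dvd_imp_le)
        thus ?thesis unfolding S using True
          by (intro cover_boundI[of "{Suc k1}" "{Suc l2}"]) auto
      next
        case False
        hence "p ^ 2 * q \<le> card A \<or> p * q ^ 2 \<le> card A"
          using u less.prems(5,6) assms(7-9) by (intro three_scales) auto
        thus ?thesis
        proof
          assume "p ^ 2 * q \<le> card A"
          thus ?thesis unfolding S using False
            by (intro cover_boundI[of "{Suc k, Suc k1}" "{Suc l2}"]) (auto simp: power2_eq_square)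
        next
          assume "p * q ^ 2 \<le> card A"
          thus ?thesis unfolding S using False
            by (intro cover_boundI[of "{Suc k1}" "{Suc l, Suc l2}"]) (auto simp: power2_eq_square)
        qed
      qed
    qed
  qed
qed


subsection \<open>Cyclotomic divisibility in terms of digits\<close>

text \<open>The linear functional sending \<open>monom 1 i\<close> to \<open>f i\<close>. For
  \<open>f\<close> the indicator of a residue class, its value at a mask polynomial counts elements,
  so divisibility becomes a statement about counts without passing to roots of unity.\<close>

definition coeff_sum :: "(nat \<Rightarrow> int) \<Rightarrow> int poly \<Rightarrow> int" where
  "coeff_sum f P = (\<Sum>i\<le>degree P. coeff P i * f i)"

lemma coeff_sum_altdef:
  assumes "degree P \<le> n"
  shows "coeff_sum f P = (\<Sum>i\<le>n. coeff P i * f i)"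
  unfolding coeff_sum_def
  by (rule sum.mono_neutral_left) (use assms in \<open>auto simp: coeff_eq_0\<close>)

lemma coeff_sum_add: "coeff_sum f (P + Q) = coeff_sum f P + coeff_sum f Q"
proof -
  let ?n = "max (degree P) (degree Q)"
  have "degree (P + Q) \<le> ?n" by (rule degree_add_le_max)
  thus ?thesis
    by (simp add: coeff_sum_altdef[of _ ?n] sum.distrib algebra_simps)
qed

lemma coeff_sum_0 [simp]: "coeff_sum f 0 = 0"
  by (simp add: coeff_sum_def)

lemma coeff_sum_minus: "coeff_sum f (- P) = - coeff_sum f P"
  by (simp add: coeff_sum_def sum_negf)

lemma coeff_sum_diff: "coeff_sum f (P - Q) = coeff_sum f P - coeff_sum f Q"
  using coeff_sum_add[of f P "- Q"] by (simp add: coeff_sum_minus)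

lemma coeff_sum_sum: "coeff_sum f (\<Sum>x\<in>X. P x) = (\<Sum>x\<in>X. coeff_sum f (P x))"
  by (induction X rule: infinite_finite_induct) (simp_all add: coeff_sum_add)

lemma coeff_sum_monom: "coeff_sum f (monom c n) = c * f n"
proof -
  have "coeff_sum f (monom c n) = (\<Sum>i\<le>n. coeff (monom c n) i * f i)"
    by (intro coeff_sum_altdef degree_monom_le)
  also have "\<dots> = (\<Sum>i\<le>n. if i = n then c * f n else 0)"
    by (intro sum.cong) auto
  finally show ?thesis by simp
qed

text \<open>Multiples of \<open>monom 1 N - 1\<close> are combinations of differences
  \<open>monom 1 (i + N) - monom 1 i\<close>, on which a function of period \<open>N\<close>
  vanishes.\<close>

lemma coeff_sum_periodic:
  assumes "monom 1 N - 1 dvd P" "\<And>n. f (n + N) = f n"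
  shows "coeff_sum f P = 0"
proof -
  obtain Q where P: "P = (monom 1 N - 1) * Q" using assms(1) by blast
  have "P = (monom 1 N - 1) * (\<Sum>i\<le>degree Q. monom (coeff Q i) i)"
    by (simp add: P poly_as_sum_of_monoms)
  also have "\<dots> = (\<Sum>i\<le>degree Q. monom (coeff Q i) (i + N) - monom (coeff Q i) i)"
    by (simp add: sum_distrib_left left_diff_distrib mult_monom add.commute)
  finally show ?thesis
    by (simp only: coeff_sum_sum coeff_sum_diff coeff_sum_monom assms(2)) simp
qed

lemma monom_minus_1_dvd: "monom 1 m - 1 dvd monom 1 (n * m) - (1 :: int poly)"
  using geometric_monom[of m n] by (metis dvd_triv_left)

lemma proper_divisor_dvd:
  fixes N :: nat
  assumes "d dvd N" "d \<noteq> N" "N > 0"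
  obtains r where "prime r" "r dvd N" "d dvd N div r"
proof -
  obtain e where e: "N = d * e" using assms(1) by blast
  have "e \<noteq> 1" using assms(2) e by auto
  then obtain r where r: "prime r" "r dvd e" using prime_factor_nat by blast
  then obtain g where g: "e = r * g" by blast
  have "N div r = d * g" using r e g prime_gt_0_nat by (simp add: mult.left_commute)
  thus ?thesis using that[of r] r e by auto
qed

lemma cyclotomic_split:
  assumes "N > 0"
  shows "monom 1 N - 1 = cyclotomic N * (\<Prod>d | d dvd N \<and> d \<noteq> N. cyclotomic d)"
proof -
  have "{d. d dvd N} = insert N {d. d dvd N \<and> d \<noteq> N}" by auto
  hence "(\<Prod>d | d dvd N. cyclotomic d) = (\<Prod>d\<in>insert N {d. d dvd N \<and> d \<noteq> N}. cyclotomic d)" by simp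
  also have "\<dots> = cyclotomic N * (\<Prod>d | d dvd N \<and> d \<noteq> N. cyclotomic d)" using assms by simp
  finally show ?thesis using prod_cyclotomic[OF assms] by simp
qed

lemma prod_union_dvd:
  fixes f :: "'a \<Rightarrow> 'b::comm_semiring_1"
  assumes "finite A" "finite B"
  shows "prod f (A \<union> B) dvd prod f A * prod f B"
  by (metis assms dvd_triv_left prod.union_inter)

text \<open>The remaining cyclotomic factors of \<open>monom 1 (p ^ Suc k) - 1\<close> have index
  dividing \<open>p ^ k\<close>, so the second factor supplies them all. It will act as a difference
  operator on the digit at \<open>k\<close>.\<close>

lemma prime_power_scale_dvd:
  assumes "prime p" "cyclotomic (p ^ Suc k) dvd P"
  shows "monom 1 (p ^ Suc k) - 1 dvd P * (monom 1 (n * p ^ k) - 1)"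
proof -
  have p0: "p > 0" using assms(1) prime_gt_0_nat by blast
  have "d dvd p ^ k" if d: "d dvd p ^ Suc k" "d \<noteq> p ^ Suc k" for d
  proof -
    obtain r where r: "prime r" "r dvd p ^ Suc k" "d dvd p ^ Suc k div r"
      using proper_divisor_dvd[OF d] p0 by auto
    hence "r = p" using assms(1) by (metis prime_dvd_power primes_dvd_imp_eq)
    thus ?thesis using r p0 by simp
  qed
  hence "(\<Prod>d | d dvd p ^ Suc k \<and> d \<noteq> p ^ Suc k. cyclotomic d) dvd (\<Prod>d | d dvd p ^ k. cyclotomic d)"
    using p0 by (intro prod_dvd_prod_subset) auto
  also have "\<dots> = monom 1 (p ^ k) - 1" using p0 by (intro prod_cyclotomic) simp
  also have "\<dots> dvd monom 1 (n * p ^ k) - 1" by (rule monom_minus_1_dvd)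
  finally show ?thesis using assms(2) p0 by (simp only: cyclotomic_split zero_less_power mult_dvd_mono)
qed

text \<open>A proper divisor of the scale divides its quotient by \<open>p\<close> or by
  \<open>q\<close>, so the two extra factors together supply all remaining cyclotomic factors. They
  will act as differences in the two digits separately.\<close>

lemma two_prime_scale_dvd:
  assumes "prime p" "prime q" "cyclotomic (p ^ Suc k * q ^ Suc l) dvd P"
  shows "monom 1 (p ^ Suc k * q ^ Suc l) - 1 dvd
    P * ((monom 1 (m * (p ^ k * q ^ Suc l)) - 1) * (monom 1 (n * (p ^ Suc k * q ^ l)) - 1))"
proof -
  have pos: "p > 0" "q > 0" using assms prime_gt_0_nat by blast+
  let ?N = "p ^ Suc k * q ^ Suc l" and ?M = "p ^ k * q ^ Suc l" and ?M' = "p ^ Suc k * q ^ l"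
  have N0: "?N > 0" "?M > 0" "?M' > 0" using pos by auto
  have "d dvd ?M \<or> d dvd ?M'" if d: "d dvd ?N" "d \<noteq> ?N" for d
  proof -
    obtain r where r: "prime r" "r dvd ?N" "d dvd ?N div r"
      using proper_divisor_dvd[OF d N0(1)] by auto
    hence "r dvd p ^ Suc k \<or> r dvd q ^ Suc l" by (simp only: prime_dvd_mult_iff)
    hence "r = p \<or> r = q" using assms(1,2) r(1) by (metis prime_dvd_power primes_dvd_imp_eq)
    moreover have "?N div p = ?M" "?N div q = ?M'" using pos by (simp_all add: mult_ac)
    ultimately show ?thesis using r(3) by auto
  qed
  hence "(\<Prod>d | d dvd ?N \<and> d \<noteq> ?N. cyclotomic d) dvd (\<Prod>d\<in>{d. d dvd ?M} \<union> {d. d dvd ?M'}. cyclotomic d)"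
    using N0 by (intro prod_dvd_prod_subset) auto
  also have "\<dots> dvd (\<Prod>d | d dvd ?M. cyclotomic d) * (\<Prod>d | d dvd ?M'. cyclotomic d)"
    using N0 by (intro prod_union_dvd) auto
  also have "\<dots> = (monom 1 ?M - 1) * (monom 1 ?M' - 1)" using N0 by (simp only: prod_cyclotomic)
  also have "\<dots> dvd (monom 1 (m * ?M) - 1) * (monom 1 (n * ?M') - 1)"
    by (intro mult_dvd_mono monom_minus_1_dvd)
  finally show ?thesis using assms(3) cyclotomic_split[OF N0(1)] by (simp only: mult_dvd_mono)
qed

section \<open>Difference operators on masks and shifts of digits\<close>

lemma coeff_sum_mask:
  assumes "finite A"
  shows "coeff_sum f (mask_poly A * (monom 1 a - 1)) = (\<Sum>n\<in>A. f (n + a)) - (\<Sum>n\<in>A. f n)"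
proof -
  have "mask_poly A * (monom 1 a - 1) = (\<Sum>n\<in>A. monom 1 (n + a) - monom 1 n)"
    by (simp add: mask_poly_def sum_distrib_right right_diff_distrib mult_monom sum_subtractf)
  thus ?thesis by (simp add: coeff_sum_sum coeff_sum_diff coeff_sum_monom sum_subtractf)
qed

lemma coeff_sum_mask2:
  assumes "finite A"
  shows "coeff_sum f (mask_poly A * ((monom 1 a - 1) * (monom 1 b - 1))) =
     (\<Sum>n\<in>A. f (n + a + b)) - (\<Sum>n\<in>A. f (n + a)) - (\<Sum>n\<in>A. f (n + b)) + (\<Sum>n\<in>A. f n)"
proof -
  have "mask_poly A * ((monom 1 a - 1) * (monom 1 b - 1)) =
      (\<Sum>n\<in>A. monom 1 (n + a + b) - monom 1 (n + a) - monom 1 (n + b) + monom 1 n)"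
    unfolding mask_poly_def sum_distrib_right
    by (intro sum.cong refl) (simp add: algebra_simps mult_monom)
  thus ?thesis
    by (simp add: coeff_sum_sum coeff_sum_diff coeff_sum_add coeff_sum_monom sum_subtractf sum.distrib)
qed

lemma dig_shift:
  assumes "p > 0" "i < p" "i' < p" "[i + m = i'] (mod p)"
  shows "dig p k (n + m * p ^ k) = i' \<longleftrightarrow> dig p k n = i"
proof -
  have "dig p k (n + m * p ^ k) = (dig p k n + m) mod p"
    using assms(1) by (simp add: dig_def mod_simps add.commute)
  moreover have "i' = (i + m) mod p" using assms by (simp add: cong_def)
  ultimately have "dig p k (n + m * p ^ k) = i' \<longleftrightarrow> [dig p k n + m = i + m] (mod p)"
    by (simp add: cong_def)
  also have "\<dots> \<longleftrightarrow> dig p k n = i"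
    using dig_less[OF assms(1)] assms(2) by (simp add: cong_add_rcancel_nat cong_less_modulus_unique_nat) (simp add: cong_def)
  finally show ?thesis .
qed

lemma dig_add_power: "dig p k (n + m * p ^ Suc k) = dig p k n"
proof (cases "p = 0")
  case False
  have "(n + m * p ^ Suc k) div p ^ k = (n + (m * p) * p ^ k) div p ^ k" by (simp add: mult_ac)
  also have "\<dots> = n div p ^ k + m * p" using False by simp
  finally show ?thesis by (simp add: dig_def)
qed (simp add: dig_def)

lemma obtain_shift:
  fixes p Q i i' :: nat
  assumes "coprime p Q" "p > 0"
  obtains m where "[i + m * Q = i'] (mod p)"
proof -
  obtain x where x: "[Q * x = 1] (mod p)" using cong_solve_coprime_nat[of Q p] assms(1) by (auto simp: coprime_commute)
  \<comment> \<open>The term \<open>(p - 1) * i\<close> represents \<open>- i\<close> modulo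
    \<open>p\<close> within the naturals.\<close>
  hence "[x * Q * (i' + (p - 1) * i) = i' + (p - 1) * i] (mod p)"
    using cong_scalar_right[OF x, of "i' + (p - 1) * i"] by (simp add: mult.commute)
  hence "[i + x * Q * (i' + (p - 1) * i) = i + (i' + (p - 1) * i)] (mod p)" by (rule cong_add[OF cong_refl])
  moreover have "i + (i' + (p - 1) * i) = i' + p * i"
    using assms(2) by (cases p) (simp_all add: algebra_simps)
  hence "[i + (i' + (p - 1) * i) = i'] (mod p)" by (simp only: cong_def mod_mult_self2)
  ultimately have "[i + (x * (i' + (p - 1) * i)) * Q = i'] (mod p)"
    by (metis (no_types) cong_trans mult.assoc mult.commute)
  thus ?thesis by (rule that)
qed

lemma card_eq_sum_of_bool: "finite A \<Longrightarrow> int (card {n\<in>A. P n}) = (\<Sum>n\<in>A. of_bool (P n))"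
  by (simp add: sum_of_bool_eq Int_def)

text \<open>Shifting by \<open>m * p ^ k\<close> turns digit \<open>i\<close> into \<open>i'\<close>
  and fixes the lower residue. Applied to the indicator of the class of \<open>i'\<close>, the
  difference operator yields the difference of the two counts, which vanishes by
  periodicity.\<close>

lemma unif_of_cyclotomic:
  assumes "prime p" "finite A" "cyclotomic (p ^ Suc k) dvd mask_poly A"
  shows "unif p k A"
  unfolding unif_def
proof (intro allI impI)
  fix r i i' assume ii: "i < p" "i' < p"
  have p0: "p > 0" using ii by simp
  obtain m where m: "[i + m * 1 = i'] (mod p)" by (rule obtain_shift[of p 1, OF _ p0]) auto
  define f where "f n = (of_bool (n mod p ^ k = r \<and> dig p k n = i') :: int)" for n
  have "f (n + p ^ Suc k) = f n" for n
    using dig_add_power[of p k n 1] by (simp add: f_def)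
  hence "coeff_sum f (mask_poly A * (monom 1 (m * p ^ k) - 1)) = 0"
    by (intro coeff_sum_periodic[OF prime_power_scale_dvd[OF assms(1,3)]]) auto
  moreover have "f (n + m * p ^ k) = of_bool (n mod p ^ k = r \<and> dig p k n = i)" for n
    using dig_shift[OF p0 ii, of m k n] m by (simp add: f_def)
  ultimately have "(\<Sum>n\<in>A. of_bool (n mod p ^ k = r \<and> dig p k n = i)) = (\<Sum>n\<in>A. f n)"
    using assms(2) by (simp add: coeff_sum_mask)
  hence "int (card {n\<in>A. n mod p ^ k = r \<and> dig p k n = i}) = int (card {n\<in>A. n mod p ^ k = r \<and> dig p k n = i'})"
    using assms(2) unfolding card_eq_sum_of_bool[OF assms(2)] f_def by simp
  thus "card {n\<in>A. n mod p ^ k = r \<and> dig p k n = i} = card {n\<in>A. n mod p ^ k = r \<and> dig p k n = i'}" by simp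
qed

lemma bal_of_cyclotomic:
  assumes "prime p" "prime q" "p \<noteq> q" "finite A" "cyclotomic (p ^ Suc k * q ^ Suc l) dvd mask_poly A"
  shows "bal p k q l A"
  unfolding bal_def
proof (intro allI impI)
  fix r t i i' j j' assume ii: "i < p" "i' < p" and jj: "j < q" "j' < q"
  have pos: "p > 0" "q > 0" using ii jj by simp_all
  have co: "coprime p (q ^ Suc l)" "coprime q (p ^ Suc k)"
    using assms(1-3) by (simp_all add: primes_coprime)
  \<comment> \<open>The shift \<open>?a\<close> is a multiple of \<open>q ^ Suc l\<close>, so it
    moves only the \<open>p\<close>-digit; seen from position \<open>k\<close>, that digit moves by
    \<open>m * q ^ Suc l\<close>. The shift \<open>?b\<close> is dual, and the resulting second
    difference is the balance identity.\<close>
  obtain m where m: "[i + m * q ^ Suc l = i'] (mod p)" by (rule obtain_shift[OF co(1) pos(1)])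
  obtain n where n: "[j + n * p ^ Suc k = j'] (mod q)" by (rule obtain_shift[OF co(2) pos(2)])
  define P where "P i j x \<longleftrightarrow> x mod p ^ k = r \<and> dig p k x = i \<and> x mod q ^ l = t \<and> dig q l x = j" for i j x
  let ?f = "\<lambda>x. of_bool (P i' j' x) :: int"
  let ?a = "m * (p ^ k * q ^ Suc l)" and ?b = "n * (p ^ Suc k * q ^ l)"
  have eqs: "?a = (m * q ^ Suc l) * p ^ k" "?a = (m * p ^ k) * q ^ Suc l"
    "?b = (n * p ^ Suc k) * q ^ l" "?b = (n * q ^ l) * p ^ Suc k" by simp_all
  have mods: "(x + ?a) mod p ^ k = x mod p ^ k" "(x + ?a) mod q ^ l = x mod q ^ l"
     "(x + ?b) mod p ^ k = x mod p ^ k" "(x + ?b) mod q ^ l = x mod q ^ l" for x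
    by (simp_all add: mod_eq_0_iff_dvd flip: mod_add_right_eq)
  have digs: "dig q l (x + ?a) = dig q l x" "dig p k (x + ?b) = dig p k x"
    "dig p k (x + ?a) = i' \<longleftrightarrow> dig p k x = i" "dig q l (x + ?b) = j' \<longleftrightarrow> dig q l x = j" for x
    using dig_add_power[of q l x "m * p ^ k"] dig_add_power[of p k x "n * q ^ l"]
      dig_shift[OF pos(1) ii m, of k x] dig_shift[OF pos(2) jj n, of l x]
    unfolding eqs[symmetric] .
  have "?f (x + p ^ Suc k * q ^ Suc l) = ?f x" for x
  proof -
    have "(x + p ^ Suc k * q ^ Suc l) mod p ^ k = x mod p ^ k" "(x + p ^ Suc k * q ^ Suc l) mod q ^ l = x mod q ^ l"
      by (simp_all add: mod_eq_0_iff_dvd flip: mod_add_right_eq)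
    thus ?thesis
      using dig_add_power[of p k x "q ^ Suc l"] dig_add_power[of q l x "p ^ Suc k"]
      by (simp only: P_def mult.commute)
  qed
  hence "coeff_sum ?f (mask_poly A * ((monom 1 ?a - 1) * (monom 1 ?b - 1))) = 0"
    by (intro coeff_sum_periodic[OF two_prime_scale_dvd[OF assms(1,2,5)]])
  moreover have "P i' j' (x + ?a + ?b) \<longleftrightarrow> P i j x" "P i' j' (x + ?a) \<longleftrightarrow> P i j' x"
     "P i' j' (x + ?b) \<longleftrightarrow> P i' j x" for x
    by (simp_all only: P_def mods digs)
  ultimately have "int (card {x\<in>A. P i j x}) - int (card {x\<in>A. P i j' x}) -
      int (card {x\<in>A. P i' j x}) + int (card {x\<in>A. P i' j' x}) = 0"
    by (simp only: card_eq_sum_of_bool[OF assms(4)] coeff_sum_mask2[OF assms(4)])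
  moreover have "cell p k q l A r t i j = {x\<in>A. P i j x}" for i j
    by (simp only: cell_def P_def)
  ultimately show "card (cell p k q l A r t i j) + card (cell p k q l A r t i' j') =
     card (cell p k q l A r t i j') + card (cell p k q l A r t i' j)" by simp
qed

lemma scale_cond_of_cyclotomic:
  assumes "prime p" "prime q" "p \<noteq> q" "finite A" "cyclotomic (p ^ a * q ^ b) dvd mask_poly A"
  shows "scale_cond p q A (a, b)"
  using assms unif_of_cyclotomic[of p A] unif_of_cyclotomic[of q A] bal_of_cyclotomic[of p q A]
  by (cases a; cases b) simp_all

subsection \<open>Fibered sets\<close>

lemma fiber_poly_times:
  assumes "prime p" "p dvd N"
  shows "(monom 1 (N div p) - 1) * fiber_poly N p = monom 1 N - 1"
  using assms geometric_monom[of "N div p" p] by (simp add: fiber_poly_eq)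

text \<open>The fiber polynomial is the quotient of \<open>monom 1 N - 1\<close> by
  \<open>monom 1 (N div p) - 1\<close>, and \<open>N\<close> does not divide
  \<open>N div p\<close>.\<close>

lemma cyclotomic_dvd_fiber_poly:
  assumes "prime p" "p dvd N" "N > 0"
  shows "cyclotomic N dvd fiber_poly N p"
proof -
  have M: "N div p > 0" "N div p < N"
    using assms prime_gt_1_nat by (auto simp: div_greater_zero_iff dvd_imp_le prime_gt_0_nat)
  have "N \<notin> {d. d dvd N div p}" using M by (auto dest: dvd_imp_le)
  hence "cyclotomic N * (\<Prod>d | d dvd N div p. cyclotomic d) = (\<Prod>d\<in>insert N {d. d dvd N div p}. cyclotomic d)"
    using M by simp
  also have "\<dots> dvd (\<Prod>d | d dvd N. cyclotomic d)"
    using assms(2,3) by (intro prod_dvd_prod_subset) (auto elim!: dvdE)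
  finally have "cyclotomic N * (monom 1 (N div p) - 1) dvd (monom 1 (N div p) - 1) * fiber_poly N p"
    using assms M by (simp add: prod_cyclotomic fiber_poly_times)
  thus ?thesis using monom_minus_1_nonzero[OF M(1)] by (simp add: mult.commute)
qed

text \<open>The cyclotomic polynomial divides both the modulus and the fiber polynomial. Hence every
  set competing for \<open>FIB_card\<close> competes for \<open>MIN_card\<close>, which is the easy
  inequality.\<close>

lemma fibered_imp_cyclotomic_dvd:
  assumes "fibered_on_scale A N" "N > 0"
  shows "cyclotomic N dvd mask_poly A"
proof -
  obtain p Q where p: "prime p" "p dvd N" and Q: "monom 1 N - 1 dvd mask_poly A - Q * fiber_poly N p"
    using assms(1) unfolding fibered_on_scale_def by blast
  have "cyclotomic N dvd monom 1 N - 1" using cyclotomic_split[OF assms(2)] by (metis dvd_triv_left)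
  hence "cyclotomic N dvd mask_poly A - Q * fiber_poly N p" using Q by (rule dvd_trans)
  moreover have "cyclotomic N dvd Q * fiber_poly N p"
    using cyclotomic_dvd_fiber_poly[OF p assms(2)] by simp
  ultimately show ?thesis by (metis dvd_add_left_iff diff_add_cancel)
qed

lemma MIN_card_le_FIB_card:
  assumes "finite S" "S \<subseteq> {2..}"
  shows "MIN_card S \<le> FIB_card S"
proof -
  obtain A where A: "finite A" "A \<noteq> {}" "card A = FIB_card S" "\<forall>s\<in>S. fibered_on_scale A s"
    using FIB_card_attained[OF assms] by blast
  have "\<forall>s\<in>S. cyclotomic s dvd mask_poly A"
    using A(4) assms(2) by (auto intro!: fibered_imp_cyclotomic_dvd)
  thus ?thesis unfolding MIN_card_def using A by (intro Least_le) blast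
qed

text \<open>Modulo the left-hand side, exponents divided by \<open>c\<close> only matter modulo \<open>p\<close>.\<close>

lemma fiber_sum_dvd:
  assumes "coprime p u" "p > 0"
  shows "(\<Sum>i<p. monom 1 (i * c)) dvd (\<Sum>i<p. monom (1::int) (i * (c * u)))"
proof -
  let ?F = "\<Sum>i<p. monom (1::int) (i * c)"
  have F: "?F dvd monom 1 (m * (p * c)) - 1" for m
  proof -
    have "?F dvd (monom 1 c - 1) * ?F" by (rule dvd_triv_right)
    also have "\<dots> = monom 1 (p * c) - 1" by (rule geometric_monom)
    also have "\<dots> dvd monom 1 (m * (p * c)) - 1" by (rule monom_minus_1_dvd)
    finally show ?thesis .
  qed
  \<comment> \<open>Multiplication by \<open>u\<close> permutes the residues modulo
    \<open>p\<close>, so the two sums can be compared term by term.\<close>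
  have inj: "inj_on (\<lambda>i. i * u mod p) {..<p}"
  proof (rule inj_onI)
    fix i j assume ij: "i \<in> {..<p}" "j \<in> {..<p}" "i * u mod p = j * u mod p"
    hence "[i = j] (mod p)" using assms(1) by (simp add: cong_def[symmetric] cong_mult_rcancel_nat coprime_commute)
    thus "i = j" using ij by (simp add: cong_def)
  qed
  have "(\<lambda>i. i * u mod p) ` {..<p} = {..<p}"
    using assms(2) by (intro endo_inj_surj inj) auto
  hence "?F = (\<Sum>i<p. monom 1 ((i * u mod p) * c))"
    using sum.reindex[OF inj, of "\<lambda>i. monom (1::int) (i * c)"] by simp
  hence "(\<Sum>i<p. monom (1::int) (i * (c * u))) =
      (\<Sum>i<p. monom 1 (i * (c * u)) - monom 1 ((i * u mod p) * c)) + ?F"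
    by (simp add: sum_subtractf)
  moreover have "?F dvd monom 1 (i * (c * u)) - monom 1 ((i * u mod p) * c)" for i
  proof -
    have "i * (c * u) = (i * u mod p) * c + (i * u div p) * (p * c)"
      by (metis (no_types, lifting) add_mult_distrib mod_mult_div_eq mult.assoc mult.commute)
    hence "monom (1::int) (i * (c * u)) - monom 1 ((i * u mod p) * c) =
        monom 1 ((i * u mod p) * c) * (monom 1 ((i * u div p) * (p * c)) - 1)"
      by (simp add: right_diff_distrib mult_monom)
    thus ?thesis using F by simp
  qed
  ultimately show ?thesis by (metis (no_types, lifting) dvd_add dvd_refl dvd_sum)
qed

text \<open>\<open>A'\<close> consists of \<open>p\<close> translates of \<open>A\<close> with step
  \<open>c = p ^ k * R\<close>. As \<open>R\<close> is prime to \<open>p\<close> and a multiple of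
  every \<open>w\<close> in \<open>T\<close>, \<open>fiber_sum_dvd\<close> shows that this single
  progression is fibered on all scales \<open>p ^ Suc k * w\<close>.\<close>

lemma extend_by_fiber:
  assumes "finite A" "A \<noteq> {}" "prime p" "finite T" "\<forall>w\<in>T. w > 0 \<and> \<not> p dvd w"
  shows "\<exists>A'. finite A' \<and> A' \<noteq> {} \<and> card A' = p * card A \<and> mask_poly A dvd mask_poly A' \<and>
     (\<forall>w\<in>T. fiber_poly (p ^ Suc k * w) p dvd mask_poly A')"
proof -
  have p0: "p > 0" using assms(3) prime_gt_0_nat by blast
  \<comment> \<open>The second factor makes \<open>c\<close> exceed all elements of \<open>A\<close>, so that the translates are disjoint.\<close>
  define R where "R = (\<Prod>w\<in>T. w) * (1 + p * Suc (Max A))"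
  define c where "c = p ^ k * R"
  have T0: "(\<Prod>w\<in>T. w) > 0" using assms(5) by (intro prod_pos) auto
  have big: "a < c" if "a \<in> A" for a
  proof -
    have "a < Suc (Max A)" using that assms(1) by (simp add: le_imp_less_Suc)
    also have "\<dots> \<le> p * Suc (Max A)" using p0 by (metis One_nat_def Suc_leI mult_le_mono1 nat_mult_1)
    also have "\<dots> \<le> R" using T0 by (simp add: R_def Suc_leI trans_le_add2)
    also have "\<dots> \<le> c" using p0 by (simp add: c_def)
    finally show ?thesis .
  qed
  let ?g = "\<lambda>(a, i). a + i * c"
  have inj: "inj_on ?g (A \<times> {..<p})"
  proof (rule inj_onI, clarify)
    fix a i a' i' assume h: "a \<in> A" "a' \<in> A" "a + i * c = a' + i' * c"
    have "(a + i * c) mod c = a" "(a' + i' * c) mod c = a'"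
      using big[OF h(1)] big[OF h(2)] by (simp_all only: mod_mult_self1 mod_less)
    hence "a = a'" using h(3) by simp
    thus "a = a' \<and> i = i'" using h big[of a] by auto
  qed
  define A' where "A' = ?g ` (A \<times> {..<p})"
  have mask: "mask_poly A' = mask_poly A * (\<Sum>i<p. monom 1 (i * c))"
    unfolding mask_poly_def A'_def sum.reindex[OF inj]
    by (simp add: sum_product sum.cartesian_product mult_monom case_prod_unfold)
  have "fiber_poly (p ^ Suc k * w) p dvd mask_poly A'" if w: "w \<in> T" for w
  proof -
    obtain u where u: "(\<Prod>w\<in>T. w) = w * u" using w assms(4) by (metis dvdE dvd_prodI)
    have "\<not> p dvd (\<Prod>w\<in>T. w)" using assms by (auto simp: prime_dvd_prod_iff)
    hence "\<not> p dvd u" using u by auto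
    moreover have "\<not> p dvd 1 + p * Suc (Max A)"
      using assms(3) by (metis dvd_add_left_iff dvd_triv_left not_prime_unit)
    ultimately have "\<not> p dvd u * (1 + p * Suc (Max A))"
      using assms(3) by (simp only: prime_dvd_mult_iff) blast
    hence "coprime p (u * (1 + p * Suc (Max A)))" using assms(3) by (intro prime_imp_coprime)
    from fiber_sum_dvd[OF this p0, of "p ^ k * w"]
    have "(\<Sum>i<p. monom 1 (i * (p ^ k * w))) dvd (\<Sum>i<p. monom (1::int) (i * c))"
      unfolding c_def R_def u by (simp only: mult.assoc)
    moreover have "p ^ Suc k * w div p = p ^ k * w" using p0 by simp
    ultimately show ?thesis unfolding mask fiber_poly_eq[OF assms(3)] by (metis dvd_mult)
  qed
  moreover have "card A' = p * card A" "finite A'" "A' \<noteq> {}"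
    unfolding A'_def using card_image[OF inj] assms(1,2) p0 by (auto simp: lessThan_empty_iff)
  ultimately show ?thesis using mask by (metis dvd_triv_left)
qed

text \<open>Each pair in \<open>I\<close> is one extension step, costing a factor \<open>p\<close>;
  earlier divisibilities survive because the old mask divides the new one. One \<open>T\<close>
  holds the cofactors for all primes, hence the condition on \<open>w\<close>.\<close>

lemma fibered_set_exists:
  assumes "finite I" "\<forall>(p, k)\<in>I. prime p" "finite T"
  shows "\<exists>A. finite A \<and> A \<noteq> {} \<and> card A = (\<Prod>(p, k)\<in>I. p) \<and>
     (\<forall>(p, k)\<in>I. \<forall>w\<in>T. w > 0 \<and> \<not> p dvd w \<longrightarrow> fiber_poly (p ^ Suc k * w) p dvd mask_poly A)"
  using assms(1,2)
proof (induction I rule: finite_induct)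
  case empty
  show ?case by (intro exI[of _ "{0}"]) simp
next
  case (insert x I)
  obtain p k where x: "x = (p, k)" by force
  obtain A where A: "finite A" "A \<noteq> {}" "card A = (\<Prod>(p, k)\<in>I. p)"
    "\<forall>(p, k)\<in>I. \<forall>w\<in>T. w > 0 \<and> \<not> p dvd w \<longrightarrow> fiber_poly (p ^ Suc k * w) p dvd mask_poly A"
    using insert by auto
  obtain A' where A': "finite A'" "A' \<noteq> {}" "card A' = p * card A" "mask_poly A dvd mask_poly A'"
    "\<forall>w\<in>{w\<in>T. w > 0 \<and> \<not> p dvd w}. fiber_poly (p ^ Suc k * w) p dvd mask_poly A'"
  proof -
    have "prime p" using insert.prems x by auto
    moreover have "finite {w\<in>T. w > 0 \<and> \<not> p dvd w}" using assms(3) by simp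
    moreover have "\<forall>w\<in>{w\<in>T. w > 0 \<and> \<not> p dvd w}. w > 0 \<and> \<not> p dvd w" by blast
    ultimately have "\<exists>A'. finite A' \<and> A' \<noteq> {} \<and> card A' = p * card A \<and> mask_poly A dvd mask_poly A' \<and>
       (\<forall>w\<in>{w\<in>T. w > 0 \<and> \<not> p dvd w}. fiber_poly (p ^ Suc k * w) p dvd mask_poly A')"
      by (rule extend_by_fiber[OF A(1,2)])
    thus ?thesis using that by blast
  qed
  have "fiber_poly (p' ^ Suc k' * w) p' dvd mask_poly A'"
    if "(p', k') \<in> insert x I" "w \<in> T" "w > 0" "\<not> p' dvd w" for p' k' w
    using that A(4) A'(4,5) x by (blast intro: dvd_trans)
  thus ?case using A' A(3) insert.hyps x by (intro exI[of _ A']) auto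
qed

lemma FIB_card_le:
  assumes "cover_bound p q R m" "finite R" "prime p" "prime q" "p \<noteq> q"
    and "S = (\<lambda>(a, b). p ^ a * q ^ b) ` R"
  shows "FIB_card S \<le> m"
proof -
  obtain E F where EF: "finite E" "finite F" "0 \<notin> E" "0 \<notin> F"
     "\<forall>s\<in>R. fst s \<in> E \<or> snd s \<in> F" "p ^ card E * q ^ card F \<le> m"
    using assms(1) unfolding cover_bound_def by blast
  \<comment> \<open>Exponents become digit positions; nothing is truncated since 0 is in neither
    \<open>E\<close> nor \<open>F\<close>.\<close>
  define K where "K = (\<lambda>e. e - 1) ` E"
  define L where "L = (\<lambda>e. e - 1) ` F"
  define I where "I = {p} \<times> K \<union> {q} \<times> L"
  \<comment> \<open>The cofactors of the scales: powers of \<open>q\<close> for fibers in direction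
    \<open>p\<close>, and conversely.\<close>
  define T where "T = (\<lambda>(a, b). q ^ b) ` R \<union> (\<lambda>(a, b). p ^ a) ` R"
  have pos: "p > 0" "q > 0" using assms(3,4) prime_gt_0_nat by blast+
  have nd: "\<not> p dvd q ^ n" "\<not> q dvd p ^ n" for n
    using assms(3-5) by (metis prime_dvd_power primes_dvd_imp_eq)+
  have "finite I" "finite T" using EF assms(2) by (auto simp: I_def K_def L_def T_def)
  then obtain A where A: "finite A" "A \<noteq> {}" "card A = (\<Prod>(p, k)\<in>I. p)"
    "\<forall>(p, k)\<in>I. \<forall>w\<in>T. w > 0 \<and> \<not> p dvd w \<longrightarrow> fiber_poly (p ^ Suc k * w) p dvd mask_poly A"
    using fibered_set_exists[of I T] assms(3,4) by (auto simp: I_def)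
  have "(\<Prod>(p, k)\<in>I. p) = (\<Prod>(p, k)\<in>{p} \<times> K. p) * (\<Prod>(p, k)\<in>{q} \<times> L. p)"
    unfolding I_def using assms(5) EF by (intro prod.union_disjoint) (auto simp: K_def L_def)
  also have "\<dots> = p ^ card K * q ^ card L"
    by (simp flip: prod.cartesian_product)
  also have "\<dots> \<le> p ^ card E * q ^ card F"
    unfolding K_def L_def using EF pos by (intro mult_le_mono power_increasing card_image_le) auto
  finally have card: "card A \<le> m" using A(3) EF(6) by linarith
  have "fibered_on_scale A s" if "s \<in> S" for s
  proof -
    obtain a b where ab: "(a, b) \<in> R" "s = p ^ a * q ^ b" using \<open>s \<in> S\<close> unfolding assms(6) by auto
    have "\<exists>r. prime r \<and> r dvd s \<and> fiber_poly s r dvd mask_poly A"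
    proof (cases "a \<in> E")
      case True
      then obtain k where k: "a = Suc k" using EF(3) by (cases a) auto
      hence "(p, k) \<in> I" using True by (force simp: I_def K_def)
      moreover have "q ^ b \<in> T" using ab(1) by (force simp: T_def)
      ultimately have "fiber_poly (p ^ Suc k * q ^ b) p dvd mask_poly A" using A(4) nd pos by fastforce
      thus ?thesis using assms(3) ab(2) k by (intro exI[of _ p]) auto
    next
      case False
      hence "b \<in> F" using EF(5) ab(1) by force
      then obtain k where k: "b = Suc k" using EF(4) by (cases b) auto
      hence "(q, k) \<in> I" using \<open>b \<in> F\<close> by (force simp: I_def L_def)
      moreover have "p ^ a \<in> T" using ab(1) by (force simp: T_def)
      ultimately have "fiber_poly (q ^ Suc k * p ^ a) q dvd mask_poly A" using A(4) nd pos by fastforce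
      thus ?thesis using assms(4) ab(2) k by (intro exI[of _ q]) (auto simp: mult.commute)
    qed
    thus ?thesis unfolding fibered_on_scale_def by (metis diff_self dvd_0_right dvdE mult.commute)
  qed
  hence "FIB_card S \<le> card A" unfolding FIB_card_def using A by (intro Least_le) blast
  thus ?thesis using card by linarith
qed

section \<open>Reduction to two primes and conclusion\<close>

theorem theorem1p2:
  fixes S :: "nat set"
  assumes "S \<subseteq> {2..}"
    and "1 \<le> card S" and "card S \<le> 3"
    and "card (prime_factors (Lcm S)) \<le> 2"
  shows "MIN_card S = FIB_card S"
proof (rule antisym)
  have fin: "finite S" using assms(2) by (intro card_ge_0_finite) simp
  show "MIN_card S \<le> FIB_card S" using fin assms(1) by (rule MIN_card_le_FIB_card)
  have L0: "Lcm S \<noteq> 0" using fin assms(1) by (auto simp: Lcm_0_iff)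
  \<comment> \<open>If the least common multiple has fewer than two prime factors, the set is padded
    with further primes, which then occur with exponent 0.\<close>
  have "\<exists>p q. prime p \<and> prime q \<and> p \<noteq> q \<and> prime_factors (Lcm S) \<subseteq> {p, q}"
  proof -
    have inf: "infinite {p::nat. prime p}" by (rule primes_infinite)
    obtain D where D: "finite D" "card D = 2" "D \<subseteq> {p::nat. prime p}"
      using infinite_arbitrarily_large[OF inf, of 2] by auto
    have "2 \<le> card (prime_factors (Lcm S) \<union> D)" using D card_mono[of "prime_factors (Lcm S) \<union> D" D] by auto
    then obtain B where B: "prime_factors (Lcm S) \<subseteq> B" "B \<subseteq> prime_factors (Lcm S) \<union> D" "card B = 2"
      using exists_subset_between[of "prime_factors (Lcm S)" 2 "prime_factors (Lcm S) \<union> D"] assms(4) D(1)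
      by auto
    have "B \<subseteq> {p. prime p}" using B(2) D(3) in_prime_factors_imp_prime by blast
    moreover obtain p q where "B = {p, q}" "p \<noteq> q" using B(3) by (auto simp: card_2_iff)
    ultimately show ?thesis using B(1) by auto
  qed
  then obtain p q where pq: "prime p" "prime q" "p \<noteq> q" "prime_factors (Lcm S) \<subseteq> {p, q}" by blast
  have "\<exists>a b. s = p ^ a * q ^ b" if "s \<in> S" for s
  proof -
    have s0: "s \<noteq> 0" using that assms(1) by auto
    have "prime_factors s \<subseteq> {p, q}"
      using dvd_prime_factors[OF L0 dvd_Lcm[OF that]] pq(4) by blast
    have "s = (\<Prod>r\<in>prime_factors s. r ^ multiplicity r s)"
      using s0 by (intro prime_factorization_nat) simp
    also have "\<dots> = (\<Prod>r\<in>{p, q}. r ^ multiplicity r s)"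
      using \<open>prime_factors s \<subseteq> {p, q}\<close> pq(1,2) s0
      by (intro prod.mono_neutral_left) (auto simp: prime_factors_multiplicity)
    finally have "s = (\<Prod>r\<in>{p, q}. r ^ multiplicity r s)" .
    thus ?thesis using pq(3) by auto
  qed
  hence "\<forall>s\<in>S. \<exists>x. s = p ^ fst x * q ^ snd x" by auto
  then obtain f where f: "\<And>s. s \<in> S \<Longrightarrow> s = p ^ fst (f s) * q ^ snd (f s)"
    unfolding bchoice_iff by blast
  define R where "R = f ` S"
  have SR: "S = (\<lambda>(a, b). p ^ a * q ^ b) ` R"
    using f by (force simp: R_def case_prod_unfold image_image)
  obtain A where A: "finite A" "A \<noteq> {}" "card A = MIN_card S" "\<forall>s\<in>S. cyclotomic s dvd mask_poly A"
    using MIN_card_attained[OF fin assms(1)] by blast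
  \<comment> \<open>A minimizer for \<open>MIN_card\<close> provides a cover, whose cost bounds
    \<open>FIB_card\<close>.\<close>
  have "cover_bound p q R (card A)"
  proof (rule cover_bound_card)
    show "finite R" "card R \<le> 3"
      using fin card_image_le[OF fin, of f] assms(3) by (auto simp: R_def)
    show "(0, 0) \<notin> R" using SR assms(1) by force
    show "\<forall>s\<in>R. scale_cond p q A s"
    proof
      fix s assume "s \<in> R"
      hence "p ^ fst s * q ^ snd s \<in> S" unfolding SR by (force simp: case_prod_unfold)
      thus "scale_cond p q A s"
        using scale_cond_of_cyclotomic[OF pq(1-3) A(1), of "fst s" "snd s"] A(4) by simp
    qed
    show "coprime p q" using pq(1-3) by (rule primes_coprime)
  qed (use A pq(1,2) prime_gt_0_nat in blast)+
  thus "FIB_card S \<le> MIN_card S"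
    using FIB_card_le[OF _ _ pq(1-3) SR] fin A(3) by (simp add: R_def)
qed

end
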